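(* Let $\lambda>-1/2$, $\lambda\neq 0$, and $\rho>1$. There is a sequence of positive numbers $c=c_n$ with $c_n\to 1$ as $n\to\infty$ such that the following holds for all $n\ge 1$. Let $u$ be analytic on and within the Bernstein ellipse $\mathcal E_\rho$, let $M_\rho=\max_{z\in\mathcal E_\rho}|u(z)|$, and let $I_nu$ be the polynomial of degree at most $n$ interpolating $u$ at the $n+1$ Gegenbauer-Gauss points (the zeros of $C_{n+1}^\lambda$). (i) If $\lambda>0$, then $$\max_{|x|\le 1}|(u-I_nu)(x)|\le \frac{c\,\Gamma(\lambda)M_\rho\sqrt{\rho^2+\rho^{-2}}}{\Gamma(2\lambda)(\rho-1)^2(1+\rho^{-2})^{-\lambda}}\,\frac{n^\lambda}{\rho^n}.$$ (ii) If $-1/2<\lambda<0$, then $$\max_{|x|\le 1}|(u-I_nu)(x)|\le \frac{c\,D_\lambda|\Gamma(\lambda)|M_\rho\sqrt{\rho^2+\rho^{-2}}}{(\rho-1)^2(1-\rho^{-2})^{-\lambda}}\,\frac{1}{\rho^n},$$ where $D_\lambda$ is a positive constant independent of $n$ such that $|C_n^\lambda(x)|\le D_\lambda n^{\lambda-1}$ for all $x\in[-1,1]$ and all sufficiently large $n$.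
   Context: For $\lambda>-1/2$, $\lambda\ne0$, the Gegenbauer polynomials are defined by $C_0^\lambda(x)=1$, $C_1^\lambda(x)=2\lambda x$, and $nC_n^\lambda(x)=2(n+\lambda-1)xC_{n-1}^\lambda(x)-(n+2\lambda-2)C_{n-2}^\lambda(x)$ for $n\ge2$. They are orthogonal on $[-1,1]$ with respect to the weight $(1-x^2)^{\lambda-1/2}$, so $C_{n+1}^\lambda$ has $n+1$ distinct zeros in $(-1,1)$. For $-1/2<\lambda<0$ a constant $D_\lambda$ as in (ii) is known to exist. For $\rho>1$ the Bernstein ellipse is $\mathcal E_\rho=\{z\in\mathbb C: z=\tfrac12(w+w^{-1}),\ w=\rho e^{\mathrm i\theta},\ \theta\in[0,2\pi]\}$; it has foci $\pm1$. *)

theory Defs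
  imports "HOL-Complex_Analysis.Complex_Analysis" "HOL-Computational_Algebra.Computational_Algebra"
begin

(* Three-term recurrence solved for the term of highest index; see gegenbauer_rec. *)
fun gegenbauer :: "real \<Rightarrow> nat \<Rightarrow> real poly" where
  "gegenbauer lam 0 = 1"
| "gegenbauer lam (Suc 0) = [:0, 2 * lam:]"
| "gegenbauer lam (Suc (Suc n)) =
     smult (1 / real (n + 2))
       (smult (2 * (real (n + 2) + lam - 1)) ([:0, 1:] * gegenbauer lam (Suc n))
        - smult (real (n + 2) + 2 * lam - 2) (gegenbauer lam n))"

lemma gegenbauer_rec:
  assumes "n \<ge> 2"
  shows "real n * poly (gegenbauer lam n) x =
           2 * (real n + lam - 1) * x * poly (gegenbauer lam (n - 1)) x
           - (real n + 2 * lam - 2) * poly (gegenbauer lam (n - 2)) x"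
proof -
  obtain m where "n = Suc (Suc m)"
    using assms by (metis One_nat_def Suc_1 Suc_le_D Suc_le_mono)
  then show ?thesis
    by (simp add: field_simps)
qed

definition bernstein_ellipse :: "real \<Rightarrow> complex set" where
  "bernstein_ellipse \<rho> =
     {(w + inverse w) / 2 | w \<theta>.
        w = complex_of_real \<rho> * exp (\<i> * complex_of_real \<theta>) \<and> \<theta> \<in> {0..2 * pi}}"

definition gegenbauer_points :: "real \<Rightarrow> nat \<Rightarrow> real set" where
  "gegenbauer_points lam n = {x. poly (gegenbauer lam (n + 1)) x = 0}"

(* For lam > -1/2, lam \<noteq> 0, gegenbauer_points lam n has n + 1 elements, so the
   interpolation conditions determine p and the description is meaningful. *)
definition gegenbauer_interp :: "real \<Rightarrow> nat \<Rightarrow> (complex \<Rightarrow> complex) \<Rightarrow> complex poly" where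
  "gegenbauer_interp lam n u =
     (THE p. degree p \<le> n \<and>
             (\<forall>x\<in>gegenbauer_points lam n. poly p (complex_of_real x) = u (complex_of_real x)))"

end

theory Submission imports Defs
begin

text \<open>Write \<open>z = (w + 1/w) / 2\<close> with \<open>|w| = \<rho>\<close>. Newton interpolation and Cauchy's formula on the ellipse give
  \<open>u x - I\<^sub>n u x = (1 / 2 \<pi> i) \<integral> C\<^sub>n\<^sub>+\<^sub>1(x) u(z) / (C\<^sub>n\<^sub>+\<^sub>1(z) (z - x)) dz\<close>. The ellipse has distance
  \<open>(\<rho> - 1)\<^sup>2 / (2 \<rho>)\<close> from \<open>[-1, 1]\<close> and length at most \<open>\<pi> sqrt (\<rho>\<^sup>2 + \<rho>\<^sup>-\<^sup>2)\<close>. With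
  \<open>a\<^sub>k = (\<lambda>)\<^sub>k / k!\<close>, the expansion \<open>C\<^sub>n(z) = \<Sum>\<^sub>k a\<^sub>k a\<^sub>n\<^sub>-\<^sub>k w\<^sup>n\<^sup>-\<^sup>2\<^sup>k\<close> and Tannery's theorem show
  \<open>C\<^sub>n(z) / (a\<^sub>n w\<^sup>n) \<longlonglongrightarrow> (1 - w\<^sup>-\<^sup>2)\<^sup>-\<^sup>\<lambda>\<close> uniformly on the ellipse, which bounds the denominator from below.
  For \<open>\<lambda> > 0\<close> the maximum of \<open>|C\<^sub>n|\<close> on \<open>[-1, 1]\<close> is \<open>C\<^sub>n(1) = (2\<lambda>)\<^sub>n / n!\<close>; for \<open>\<lambda> < 0\<close> it is controlled
  by the given envelope.\<close>

section \<open>Expansion and zeros of Gegenbauer polynomials\<close>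

text \<open>The sequence \<open>c\<close> is fixed before \<open>u\<close> and, for negative
  \<open>lam\<close>, before the envelope constant. The proof therefore separates a bound valid for
  each single degree, in which \<open>u\<close> enters only through its maximum on the ellipse, from
  the asymptotics. The quotient of that bound by the claimed one is a number \<open>K n\<close> free
  of \<open>u\<close>. Since only an upper estimate of \<open>K n\<close> tending to 1 is at hand,
  \<open>c n\<close> is the larger of 1 and \<open>K n\<close>. Origin of the constants: the
  distance estimate puts one factor \<rho> into the numerator, which turns the decay
  \<open>\<rho> ^ (n + 1)\<close> of the denominator polynomial into \<open>\<rho> ^ n\<close>. The
  factor \<open>n powr lam * Gamma lam / Gamma (2 * lam)\<close> is the growth of the ratio of
  \<open>rising_coeff (2 * lam) (n + 1)\<close> to \<open>rising_coeff lam (n + 1)\<close>. For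
  negative \<open>lam\<close> the coefficients \<open>rising_coeff lam k\<close> have mixed signs,
  so the triangle inequality no longer puts the maximum at 1; this is why an envelope is assumed
  there. The nodes must be known to be simple and to lie in (-1, 1). This is obtained from the
  recurrence alone, without orthogonality.\<close>

definition rising_coeff :: "real \<Rightarrow> nat \<Rightarrow> real" where
  "rising_coeff lam k = pochhammer lam k / fact k"

lemma rising_coeff_0 [simp]: "rising_coeff lam 0 = 1"
  by (simp add: rising_coeff_def)

lemma rising_coeff_Suc:
  "real (Suc n) * rising_coeff lam (Suc n) = (lam + real n) * rising_coeff lam n"
  by (simp add: rising_coeff_def pochhammer_Suc mult.commute del: of_nat_Suc)

lemma rising_coeff_Suc':
  "rising_coeff lam (Suc n) = (lam + real n) / real (Suc n) * rising_coeff lam n"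
  using rising_coeff_Suc[of n lam] by (simp add: field_simps)

abbreviation cpoly :: "real poly \<Rightarrow> complex poly" where
  "cpoly p \<equiv> map_poly complex_of_real p"

lemma cpoly_simps:
  "cpoly (p + q) = cpoly p + cpoly q"
  "cpoly (p - q) = cpoly p - cpoly q"
  "cpoly (smult c p) = smult (complex_of_real c) (cpoly p)"
  "cpoly (p * q) = cpoly p * cpoly q"
  "cpoly 1 = 1"
  by (auto simp: poly_eq_iff coeff_map_poly coeff_mult)

text \<open>The binomial series of \<open>(1 - w X) powr (- lam)\<close> as a formal power
  series.\<close>

definition gegenbauer_fps :: "real \<Rightarrow> complex \<Rightarrow> complex fps" where
  "gegenbauer_fps lam w = Abs_fps (\<lambda>k. of_real (rising_coeff lam k) * w ^ k)"

text \<open>This differential equation is the recurrence \<open>rising_coeff_Suc\<close> in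
  disguise. It stands in for differentiating a power with real exponent.\<close>

lemma gegenbauer_fps_deriv:
  "(1 - fps_const w * fps_X) * fps_deriv (gegenbauer_fps lam w)
     = fps_const (of_real lam * w) * gegenbauer_fps lam w"
proof (rule fps_ext)
  fix n
  have r: "complex_of_real (real (Suc n)) * of_real (rising_coeff lam (Suc n))
        = of_real (lam + real n) * of_real (rising_coeff lam n)" for n
    by (simp only: rising_coeff_Suc flip: of_real_mult)
  show "fps_nth ((1 - fps_const w * fps_X) * fps_deriv (gegenbauer_fps lam w)) n
     = fps_nth (fps_const (of_real lam * w) * gegenbauer_fps lam w) n"
  proof (cases n)
    case 0
    show ?thesis using r[of 0] unfolding 0
      by (simp add: gegenbauer_fps_def algebra_simps)
  next
    case (Suc m)
    have "fps_nth ((1 - fps_const w * fps_X) * fps_deriv (gegenbauer_fps lam w)) n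
      = (of_real (real (Suc n)) * of_real (rising_coeff lam (Suc n))) * w ^ Suc n
        - w * (of_nat n * of_real (rising_coeff lam n) * w ^ n)"
      by (simp add: gegenbauer_fps_def Suc ring_distribs mult.assoc)
    also have "\<dots> = of_real lam * w * (of_real (rising_coeff lam n) * w ^ n)"
      unfolding r by (simp add: algebra_simps)
    finally show ?thesis by (simp add: gegenbauer_fps_def)
  qed
qed

text \<open>The terms are those in \<open>w\<close> to the power \<open>n - 2 k\<close>; splitting
  off \<open>inverse w ^ k\<close> keeps all exponents natural. On the unit circle this is the
  classical cosine expansion of the Gegenbauer polynomial.\<close>

definition joukowski_sum :: "real \<Rightarrow> nat \<Rightarrow> complex \<Rightarrow> complex" where
  "joukowski_sum lam n w =
     (\<Sum>k\<le>n. of_real (rising_coeff lam k * rising_coeff lam (n - k)) * inverse w ^ k * w ^ (n - k))"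

lemma joukowski_sum_fps:
  "joukowski_sum lam n w = fps_nth (gegenbauer_fps lam (inverse w) * gegenbauer_fps lam w) n"
  unfolding joukowski_sum_def fps_mult_nth atLeast0AtMost
  by (rule sum.cong) (simp_all add: gegenbauer_fps_def)

text \<open>The generating function \<open>F = ((1 - X/w) (1 - w X))\<^sup>-\<^sup>\<lambda>\<close> satisfies
  \<open>(1 - (w + 1/w) X + X\<^sup>2) F' = \<lambda> (w + 1/w - 2 X) F\<close>, which is the Gegenbauer recurrence
  read off coefficientwise.\<close>

lemma joukowski_sum_rec:
  assumes "w \<noteq> 0"
  shows "of_nat (n + 2) * joukowski_sum lam (n + 2) w =
     of_real (real (n + 1) + lam) * (w + inverse w) * joukowski_sum lam (n + 1) w
     - of_real (real n + 2 * lam) * joukowski_sum lam n w"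
proof -
  define v where "v = inverse w"
  have vw: "v * w = 1" using assms by (simp add: v_def)
  define A B where "A = gegenbauer_fps lam v" and "B = gegenbauer_fps lam w"
  define F where "F = A * B"
  let ?L = "fps_const (complex_of_real lam)" and ?v = "fps_const v" and ?w = "fps_const w"
  have cvw: "?v * ?w = 1" using vw by (simp add: fps_const_mult)
  have dA: "(1 - ?v * fps_X) * fps_deriv A = ?L * ?v * A"
    and dB: "(1 - ?w * fps_X) * fps_deriv B = ?L * ?w * B"
    unfolding A_def B_def gegenbauer_fps_deriv by (simp_all add: fps_const_mult)
  have expand: "(1 - a * x) * (1 - b * x) = 1 - (a + b) * x + (a * b) * x\<^sup>2" for a b x :: "complex fps"
    by (simp add: algebra_simps power2_eq_square)
  have product: "(1 - a * x) * (1 - b * x) * (f * g' + f' * g)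
      = (1 - b * x) * g * ((1 - a * x) * f') + (1 - a * x) * f * ((1 - b * x) * g')"
    for a b f g f' g' x :: "complex fps"
    by (simp add: algebra_simps)
  have collect: "(1 - b * x) * g * (l * a * f) + (1 - a * x) * f * (l * b * g)
      = l * (a + b - 2 * (a * b) * x) * (f * g)" for a b f g l x :: "complex fps"
    by (simp add: algebra_simps)
  have "(1 - ?v * fps_X) * (1 - ?w * fps_X) * fps_deriv F =
      (1 - ?w * fps_X) * B * ((1 - ?v * fps_X) * fps_deriv A)
      + (1 - ?v * fps_X) * A * ((1 - ?w * fps_X) * fps_deriv B)"
    unfolding F_def fps_deriv_mult by (rule product)
  also have "\<dots> = ?L * (?v + ?w - 2 * (?v * ?w) * fps_X) * F"
    unfolding dA dB F_def by (rule collect)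
  also have "(1 - ?v * fps_X) * (1 - ?w * fps_X) = 1 - (?v + ?w) * fps_X + (?v * ?w) * fps_X^2"
    by (rule expand)
  finally have eq: "fps_deriv F - fps_const (v + w) * (fps_X * fps_deriv F) + fps_X ^ 2 * fps_deriv F
      = fps_const (of_real lam * (v + w)) * F - fps_const (2 * of_real lam) * (fps_X * F)"
    unfolding cvw by (simp add: algebra_simps numeral_fps_const flip: fps_const_add fps_const_mult)
  have "fps_nth (fps_deriv F - fps_const (v + w) * (fps_X * fps_deriv F) + fps_X ^ 2 * fps_deriv F) (n + 1)
      = fps_nth (fps_const (of_real lam * (v + w)) * F - fps_const (2 * of_real lam) * (fps_X * F)) (n + 1)"
    unfolding eq ..
  then have "of_nat (n + 2) * fps_nth F (n + 2) - (v + w) * (of_nat (n + 1) * fps_nth F (n + 1))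
        + of_nat n * fps_nth F n
      = of_real lam * (v + w) * fps_nth F (n + 1) - 2 * of_real lam * fps_nth F n"
    \<comment> \<open>For \<open>n = 0\<close> the series \<open>X^2 F'\<close> has no term of order
      1, in agreement with the factor \<open>of_nat n\<close>.\<close>
    by (cases n) (simp_all add: fps_X_power_mult_nth)
  then show ?thesis
    by (simp add: joukowski_sum_fps F_def A_def B_def v_def algebra_simps)
qed

text \<open>Both sides obey the same three-term recurrence and agree for the first two indices. As
  only \<open>w \<noteq> 0\<close> is assumed, the identity serves on the ellipse and, with
  \<open>w\<close> on the unit circle, on the interval.\<close>

lemma gegenbauer_joukowski:
  assumes "w \<noteq> 0"
  shows "poly (cpoly (gegenbauer lam n)) ((w + inverse w) / 2) = joukowski_sum lam n w"
proof (induction lam n rule: gegenbauer.induct)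
  case (1 lam)
  then show ?case by (simp add: joukowski_sum_def cpoly_simps)
next
  case (2 lam)
  then show ?case
    by (simp add: joukowski_sum_def rising_coeff_def map_poly_pCons algebra_simps)
next
  case (3 lam n)
  let ?z = "(w + inverse w) / 2"
  have X: "cpoly [:0, 1:] = [:0, 1:]" by (simp add: map_poly_pCons)
  have "of_nat (n + 2) * poly (cpoly (gegenbauer lam (Suc (Suc n)))) ?z =
     2 * of_real (real (n + 2) + lam - 1) * (?z * poly (cpoly (gegenbauer lam (Suc n))) ?z)
        - of_real (real (n + 2) + 2 * lam - 2) * poly (cpoly (gegenbauer lam n)) ?z"
  proof -
    have nz: "complex_of_nat (n + 2) \<noteq> 0" by (simp only: of_nat_eq_0_iff)
    have eq: "cpoly (gegenbauer lam (Suc (Suc n))) = smult (1 / of_nat (n + 2))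
       (smult (2 * of_real (real (n + 2) + lam - 1)) ([:0, 1:] * cpoly (gegenbauer lam (Suc n)))
        - smult (of_real (real (n + 2) + 2 * lam - 2)) (cpoly (gegenbauer lam n)))"
      unfolding gegenbauer.simps cpoly_simps X by simp
    have unscale: "of_nat (n + 2) * poly (smult (1 / of_nat (n + 2)) q) ?z = poly q ?z" for q
      using nz by (simp del: of_nat_add)
    show ?thesis unfolding eq unscale unfolding poly_diff poly_smult poly_mult by simp
  qed
  also have "\<dots> = of_nat (n + 2) * joukowski_sum lam (n + 2) w"
    unfolding 3 joukowski_sum_rec[OF assms] by (simp add: algebra_simps)
  finally show ?case by (metis (no_types, lifting) add_2_eq_Suc' mult_cancel_left of_nat_eq_0_iff nat.distinct(1))
qed

section \<open>Leading coefficients, special values and interlacing of zeros\<close>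

definition gegenbauer_lead :: "real \<Rightarrow> nat \<Rightarrow> real" where
  "gegenbauer_lead lam n = 2 ^ n * rising_coeff lam n"

lemma gegenbauer_lead_Suc:
  "gegenbauer_lead lam (Suc n) = 2 * (lam + real n) / real (Suc n) * gegenbauer_lead lam n"
  by (simp add: gegenbauer_lead_def rising_coeff_Suc')

lemma rising_coeff_nonzero:
  assumes "lam > -1/2" "lam \<noteq> 0"
  shows "rising_coeff lam n \<noteq> 0"
proof (induction n)
  case (Suc n)
  have "lam + real n \<noteq> 0" using assms by (cases n) auto
  with Suc show ?case by (simp add: rising_coeff_Suc')
qed simp

lemma gegenbauer_at_1: "poly (gegenbauer lam n) 1 = rising_coeff (2 * lam) n"
proof (induction lam n rule: gegenbauer.induct)
  case (3 lam n)
  have r: "real (n + 2) * rising_coeff (2*lam) (n + 2) = (2 * lam + real (n + 1)) * rising_coeff (2*lam) (n + 1)"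
    and r2: "real (n + 1) * rising_coeff (2*lam) (n + 1) = (2 * lam + real n) * rising_coeff (2*lam) n"
    using rising_coeff_Suc[of "Suc n" "2*lam"] rising_coeff_Suc[of "n" "2*lam"] by simp_all
  have "real (n + 2) * poly (gegenbauer lam (n + 2)) 1 = 
     2 * (real (n + 2) + lam - 1) * rising_coeff (2*lam) (n + 1)
      - (2 * lam + real n) * rising_coeff (2*lam) n"
    using 3 by simp
  also have "\<dots> = real (n + 2) * rising_coeff (2*lam) (n + 2)"
    unfolding r r2[symmetric] by (simp add: algebra_simps)
  finally show ?case by simp
qed (auto simp: rising_coeff_def)

lemma gegenbauer_minus: "poly (gegenbauer lam n) (- x) = (- 1) ^ n * poly (gegenbauer lam n) x"
  by (induction lam n rule: gegenbauer.induct) (simp_all add: algebra_simps)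

text \<open>At 0 the middle term of the recurrence disappears, which leaves a product of ratios. The
  value later bounds every envelope constant from below.\<close>

lemma gegenbauer_at_0: "\<bar>poly (gegenbauer lam (2 * m)) 0\<bar> = \<bar>rising_coeff lam m\<bar>"
proof (induction m)
  case (Suc m)
  have "poly (gegenbauer lam (2 * Suc m)) 0 = - (lam + real m) / real (Suc m) * poly (gegenbauer lam (2 * m)) 0"
    by (simp add: field_simps)
  moreover have "\<bar>- (lam + real m)\<bar> = \<bar>lam + real m\<bar>" by (rule abs_minus_cancel)
  ultimately show ?case using Suc by (simp only: rising_coeff_Suc' abs_mult abs_divide)
qed simp

text \<open>Exactly the \<open>n + 1 - j\<close> factors with index at least \<open>j\<close> are
  negative. The outer nodes \<open>x 0\<close> and \<open>x (n + 1)\<close> stand for the endpoints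
  of the interval and contribute no factor.\<close>

lemma prod_sign_between:
  fixes x :: "nat \<Rightarrow> real"
  assumes mono: "strict_mono_on {..n + 1} x" and j: "1 \<le> j" "j \<le> n + 1"
    and y: "x (j - 1) < y" "y < x j"
  shows "(- 1) ^ (n + 1 - j) * (\<Prod>i\<in>{1..n}. y - x i) > 0"
proof -
  have "{1..n} = {1..<j} \<union> {j..n}" "{1..<j} \<inter> {j..n} = {}" using j by auto
  then have "(\<Prod>i\<in>{1..n}. y - x i) = (\<Prod>i\<in>{1..<j}. y - x i) * (\<Prod>i\<in>{j..n}. y - x i)"
    by (metis finite_atLeastAtMost finite_atLeastLessThan prod.union_disjoint)
  also have "(\<Prod>i\<in>{j..n}. y - x i) = (\<Prod>i\<in>{j..n}. (-1) * (x i - y))" by simp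
  also have "\<dots> = (-1) ^ (n + 1 - j) * (\<Prod>i\<in>{j..n}. x i - y)"
    by (subst prod.distrib) simp
  finally have e: "(\<Prod>i\<in>{1..n}. y - x i)
      = (- 1) ^ (n + 1 - j) * ((\<Prod>i\<in>{1..<j}. y - x i) * (\<Prod>i\<in>{j..n}. x i - y))"
    by (simp only: mult.left_commute)
  have "(\<Prod>i\<in>{1..<j}. y - x i) > 0"
  proof (rule prod_pos)
    fix i assume i: "i \<in> {1..<j}"
    have "x i \<le> x (j - 1)"
      by (rule strict_mono_on_leD[OF mono]) (use i j in auto)
    with y show "0 < y - x i" by simp
  qed
  moreover have "(\<Prod>i\<in>{j..n}. x i - y) > 0"
  proof (rule prod_pos)
    fix i assume i: "i \<in> {j..n}"
    have "x j \<le> x i"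
      by (rule strict_mono_on_leD[OF mono]) (use i j in auto)
    with y show "0 < x i - y" by simp
  qed
  ultimately have pos: "(\<Prod>i\<in>{1..<j}. y - x i) * (\<Prod>i\<in>{j..n}. x i - y) > 0" by (rule mult_pos_pos)
  show ?thesis unfolding e left_minus_one_mult_self by (rule pos)
qed

lemma monic_eq_prod_roots:
  fixes p :: "'a::field poly"
  assumes "finite X" "degree p = card X" "lead_coeff p = 1" "\<And>x. x \<in> X \<Longrightarrow> poly p x = 0"
  shows "p = (\<Prod>x\<in>X. [:- x, 1:])"
proof (rule ccontr)
  let ?q = "\<Prod>x\<in>X. [:- x, 1:]"
  assume ne: "p \<noteq> ?q"
  have dq: "degree ?q = card X" by (subst degree_prod_sum_eq) auto
  have lq: "lead_coeff ?q = 1" by (simp add: lead_coeff_prod)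
  have c0: "coeff (p - ?q) (card X) = 0" using assms dq lq by simp
  have "degree (p - ?q) \<le> card X" by (rule degree_diff_le) (use assms dq in auto)
  moreover have "X \<subseteq> {x. poly (p - ?q) x = 0}"
    using assms by (auto simp: poly_prod prod_zero_iff)
  then have "card X \<le> card {x. poly (p - ?q) x = 0}"
    using ne by (intro card_mono poly_roots_finite) auto
  then have "card X \<le> degree (p - ?q)"
    using ne card_poly_roots_bound[of "p - ?q"] by simp
  ultimately have "degree (p - ?q) = card X" by simp
  with c0 have "lead_coeff (p - ?q) = 0" by simp
  then show False using ne by (metis leading_coeff_0_iff eq_iff_diff_eq_0)
qed

text \<open>A Sturm argument for monic polynomials: positive \<beta> makes the zeros of consecutive
  members interlace, and the prescribed signs at -1 and 1 keep all of them inside the open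
  interval.\<close>

lemma interlacing_zeros:
  fixes p :: "nat \<Rightarrow> real poly"
  assumes p0: "p 0 = 1" and p1: "p (Suc 0) = [:0, 1:]"
    and rec: "\<And>n. p (Suc (Suc n)) = [:0, 1:] * p (Suc n) - smult (\<beta> n) (p n)"
    and \<beta>: "\<And>n. \<beta> n > 0"
    and pos: "\<And>n. poly (p n) 1 > 0" and neg: "\<And>n. (- 1) ^ n * poly (p n) (- 1) > 0"
  obtains X where "finite X" "card X = n" "X \<subseteq> {-1<..<1}" "p n = (\<Prod>x\<in>X. [:- x, 1:])"
proof -
  have monic: "degree (p n) = n \<and> lead_coeff (p n) = 1" for n
  proof (induction n rule: less_induct)
    case (less n)
    consider "n = 0" | "n = 1" | m where "n = Suc (Suc m)" by (metis One_nat_def not0_implies_Suc)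
    then show ?case
    proof cases
      case 3
      have IH: "degree (p (Suc m)) = Suc m" "lead_coeff (p (Suc m)) = 1" "degree (p m) = m"
        using less[of m] less[of "Suc m"] 3 by auto
      have nz: "p (Suc m) \<noteq> 0" using IH by auto
      have d: "degree ([:0, 1:] * p (Suc m)) = n" "lead_coeff ([:0,1:] * p (Suc m)) = 1"
        using IH nz 3 by (simp_all add: degree_mult_eq lead_coeff_mult)
      have lt: "degree (- smult (\<beta> m) (p m)) < degree ([:0, 1:] * p (Suc m))"
        unfolding d degree_minus using \<beta>[of m] IH 3 by simp
      have e: "p n = - smult (\<beta> m) (p m) + [:0, 1:] * p (Suc m)"
        using rec[of m] 3 by simp
      show ?thesis unfolding e
        using degree_add_eq_right[OF lt] lead_coeff_add_le[OF lt] d by simp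
    qed (auto simp: p0 p1)
  qed
  have mono_imp_inj: "inj_on x {1..n}" if "strict_mono_on {..n + 1} x" for x :: "nat \<Rightarrow> real" and n
    using strict_mono_on_imp_inj_on[OF that] by (rule inj_on_subset) auto
  have prod: "p n = (\<Prod>x\<in>x ` {1..n}. [:- x, 1:])"
    if "strict_mono_on {..n + 1} x" "\<And>i. i \<in> {1..n} \<Longrightarrow> poly (p n) (x i) = 0" for x n
    using monic[of n] that mono_imp_inj[OF that(1)]
    by (intro monic_eq_prod_roots) (auto simp: card_image)
  \<comment> \<open>The nodes include the endpoints \<open>-1\<close> and \<open>1\<close>; recording that \<open>p (Suc n)\<close> alternates on them lets the
    intermediate value theorem produce the zeros of \<open>p (Suc n)\<close>, where the recurrence gives
    \<open>p (Suc (Suc n))\<close> the sign opposite to \<open>p n\<close>.\<close>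
  have "\<exists>x. strict_mono_on {..n + 1} x \<and> x 0 = -1 \<and> x (n + 1) = 1 \<and>
      (\<forall>i\<in>{1..n}. poly (p n) (x i) = 0) \<and>
      (\<forall>i\<le>n + 1. (- 1) ^ (n + 1 - i) * poly (p (Suc n)) (x i) > 0)"
  proof (induction n)
    case 0
    show ?case
      by (rule exI[of _ "\<lambda>i. if i = 0 then -1 else 1"])
         (auto simp: strict_mono_on_def p1 le_Suc_eq)
  next
    case (Suc n)
    then obtain x where x: "strict_mono_on {..n + 1} x" "x 0 = -1" "x (n + 1) = 1"
      "\<And>i. i \<in> {1..n} \<Longrightarrow> poly (p n) (x i) = 0"
      "\<And>i. i \<le> n + 1 \<Longrightarrow> (- 1) ^ (n + 1 - i) * poly (p (Suc n)) (x i) > 0"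
      by blast
    have "\<exists>y. x (j - 1) < y \<and> y < x j \<and> poly (p (Suc n)) y = 0" if j: "j \<in> {1..n + 1}" for j
    proof -
      have lt: "x (j - 1) < x j"
        by (rule strict_mono_onD[OF x(1)]) (use j in auto)
      obtain i where i: "j = Suc i" using j by (cases j) auto
      have "Suc (n - i) = n + 1 - i" using j i by auto
      then have s: "(- 1::real) ^ (n + 1 - i) = - ((- 1) ^ (n - i))"
        by (metis mult_minus1 power_Suc)
      have "(- 1) ^ (n + 1 - i) * poly (p (Suc n)) (x i) > 0"
        "(- 1) ^ (n - i) * poly (p (Suc n)) (x j) > 0"
        using x(5)[of i] x(5)[of j] i j by auto
      then have "poly (p (Suc n)) (x i) * poly (p (Suc n)) (x j) < 0"
        unfolding s by (cases "even (n - i)") (auto simp: mult_less_0_iff)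
      then show ?thesis using poly_IVT[OF lt] i by auto
    qed
    then obtain y where y: "\<And>j. j \<in> {1..n + 1} \<Longrightarrow> x (j - 1) < y j \<and> y j < x j \<and> poly (p (Suc n)) (y j) = 0"
      by metis
    \<comment> \<open>The new zeros are framed by the endpoints again, so that the node list for
      \<open>Suc n\<close> has the same shape as the one for \<open>n\<close>.\<close>
    define z where "z j = (if j = 0 then -1 else if j = n + 2 then 1 else y j)" for j
    have zy: "z j = y j" if "j \<in> {1..n + 1}" for j using that by (auto simp: z_def)
    have z0: "z 0 = -1" and zn: "z (Suc n + 1) = 1" by (auto simp: z_def)
    have step: "z j < z (Suc j)" if "j \<le> n + 1" for j
    proof -
      have "z j \<le> x j" "j > 0 \<Longrightarrow> z j < x j"
        using y[of j] zy[of j] that z0 x(2) by (cases "j = 0"; force)+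
      moreover have "x j \<le> z (Suc j)" "j \<noteq> n + 1 \<Longrightarrow> x j < z (Suc j)"
        using y[of "Suc j"] zy[of "Suc j"] that zn x(3) by (cases "j = n + 1"; force)+
      ultimately show ?thesis by (cases "j = 0") force+
    qed
    have mono: "strict_mono_on {..Suc n + 1} z"
    proof (rule strict_mono_onI)
      fix r s assume rs: "r \<in> {..Suc n + 1}" "s \<in> {..Suc n + 1}" "r < s"
      show "z r < z s" using rs(3,2)
      proof (induction s)
        case (Suc s)
        then show ?case using step[of s] by (cases "r = s") auto
      qed simp
    qed
    have sg: "(- 1) ^ (n + 1 - j) * poly (p n) (y j) > 0" if j: "j \<in> {1..n + 1}" for j
    proof -
      have "poly (p n) (y j) = (\<Prod>i\<in>{1..n}. y j - x i)"
      proof -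
        have "p n = (\<Prod>x\<in>x ` {1..n}. [:- x, 1:])" by (rule prod) (use x in auto)
        then show ?thesis unfolding prod.reindex[OF mono_imp_inj[OF x(1)]] by (simp add: poly_prod)
      qed
      with prod_sign_between[OF x(1), of j "y j"] y[OF j] j show ?thesis by simp
    qed
    have "(- 1) ^ (Suc n + 1 - j) * poly (p (Suc (Suc n))) (z j) > 0" if j: "j \<le> Suc n + 1" for j
    proof -
      consider "j = 0" | "j = n + 2" | "j \<in> {1..n + 1}" using j by force
      then show ?thesis
      proof cases
        case 1 then show ?thesis using neg[of "Suc (Suc n)"] z0 by simp
      next
        case 2 then show ?thesis using pos[of "Suc (Suc n)"] zn by simp
      next
        case 3
        have "poly (p (Suc (Suc n))) (z j) = - \<beta> n * poly (p n) (y j)"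
          using y[OF 3] zy[OF 3] by (simp add: rec)
        moreover have "(- 1::real) ^ (Suc n + 1 - j) = - ((- 1) ^ (n + 1 - j))"
          using 3 by (simp add: Suc_diff_le)
        ultimately have "(- 1) ^ (Suc n + 1 - j) * poly (p (Suc (Suc n))) (z j)
            = \<beta> n * ((- 1) ^ (n + 1 - j) * poly (p n) (y j))" by simp
        then show ?thesis using sg[OF 3] \<beta>[of n] by simp
      qed
    qed
    moreover have "\<forall>i\<in>{1..Suc n}. poly (p (Suc n)) (z i) = 0" using y zy by simp
    ultimately show ?case using mono z0 zn by blast
  qed
  then obtain x where x: "strict_mono_on {..n + 1} x" "x 0 = -1" "x (n + 1) = 1"
      "\<And>i. i \<in> {1..n} \<Longrightarrow> poly (p n) (x i) = 0" by blast
  show ?thesis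
  proof (rule that[of "x ` {1..n}"])
    show "card (x ` {1..n}) = n" using mono_imp_inj[OF x(1)] by (simp add: card_image)
    show "x ` {1..n} \<subseteq> {-1<..<1}"
      using strict_mono_onD[OF x(1), of 0] strict_mono_onD[OF x(1), of _ "n + 1"] x(2,3) by auto
  qed (use prod[OF x(1,4)] in auto)
qed

lemma gegenbauer_factorization:
  assumes lam: "lam > -1/2" "lam \<noteq> 0"
  obtains X where "finite X" "card X = n" "X \<subseteq> {-1<..<1}"
    "gegenbauer lam n = smult (gegenbauer_lead lam n) (\<Prod>x\<in>X. [:- x, 1:])"
proof -
  define k where "k = gegenbauer_lead lam"
  have knz: "k n \<noteq> 0" for n using rising_coeff_nonzero[OF lam] by (simp add: k_def gegenbauer_lead_def)
  define p where "p n = smult (1 / k n) (gegenbauer lam n)" for n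
  have ln: "lam + real n \<noteq> 0" for n using lam by (cases n) auto
  \<comment> \<open>The coefficient that appears when the recurrence is divided by the leading
    coefficients.\<close>
  define \<beta> where "\<beta> n = (real n + 2 * lam) * (real n + 1) / (4 * (lam + real n) * (lam + real n + 1))" for n
  have kS: "k (Suc n) = 2 * (lam + real n) / real (Suc n) * k n" for n
    unfolding k_def by (rule gegenbauer_lead_Suc)
  \<comment> \<open>The delicate case is \<open>n = 0\<close> with negative \<open>lam\<close>:
    numerator and denominator are both negative and their quotient is 2. Positivity of \<beta> and
    of the values at 1 both rest on this.\<close>
  have ratio: "(2 * lam + real n) / (lam + real n) > 0" for n
    using lam by (cases n) (auto intro!: divide_pos_pos)
  have rec: "p (Suc (Suc n)) = [:0, 1:] * p (Suc n) - smult (\<beta> n) (p n)" for n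
  proof -
    have 1: "1 / k (Suc (Suc n)) / real (n + 2) * (2 * (real (n + 2) + lam - 1)) = 1 / k (Suc n)"
    proof -
      have e: "k (Suc (Suc n)) * real (n + 2) = 2 * (real (n + 2) + lam - 1) * k (Suc n)"
      proof -
        have "k (Suc (Suc n)) * real (n + 2) = 2 * (lam + real (Suc n)) * k (Suc n)"
          unfolding kS[of "Suc n"] add_2_eq_Suc' by (simp del: of_nat_Suc)
        then show ?thesis by (simp add: algebra_simps)
      qed
      have nz: "2 * (real (n + 2) + lam - 1) \<noteq> 0" using ln[of "Suc n"] by simp
      have "1 / k (Suc (Suc n)) / real (n + 2) * (2 * (real (n + 2) + lam - 1))
          = (2 * (real (n + 2) + lam - 1)) / (k (Suc (Suc n)) * real (n + 2))" by simp
      also have "\<dots> = 1 / k (Suc n)" unfolding e using nz by simp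
      finally show ?thesis .
    qed
    have 2: "1 / k (Suc (Suc n)) / real (n + 2) * (real (n + 2) + 2 * lam - 2) = \<beta> n / k n"
    proof -
      have "k (Suc (Suc n)) * real (n + 2) * real (Suc n) = 2 * (lam + real (Suc n)) * (k (Suc n) * real (Suc n))"
        unfolding kS[of "Suc n"] add_2_eq_Suc' by (simp del: of_nat_Suc)
      also have "\<dots> = 2 * (lam + real (Suc n)) * (2 * (lam + real n) * k n)"
        unfolding kS[of n] by (simp del: of_nat_Suc)
      finally have e: "k (Suc (Suc n)) * real (n + 2) * (real n + 1) = 4 * (lam + real n) * (lam + real n + 1) * k n"
        by (simp add: algebra_simps)
      have "\<beta> n / k n = (real n + 2 * lam) * (real n + 1) / (k (Suc (Suc n)) * real (n + 2) * (real n + 1))"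
        unfolding e \<beta>_def by simp
      then show ?thesis by simp
    qed
    show ?thesis
      unfolding p_def gegenbauer.simps smult_diff_right smult_smult mult_smult_right
      using 1 2 by (simp add: divide_divide_eq_left mult.commute)
  qed
  have p01: "p 0 = 1" "p (Suc 0) = [:0, 1:]"
    using lam kS[of 0] by (simp_all add: p_def k_def gegenbauer_lead_def)
  have \<beta>pos: "\<beta> n > 0" for n
  proof -
    have "\<beta> n = (2 * lam + real n) / (lam + real n) * ((real n + 1) / (4 * (lam + real n + 1)))"
      by (simp add: \<beta>_def algebra_simps)
    moreover have "(real n + 1) / (4 * (lam + real n + 1)) > 0" using lam by simp
    ultimately show ?thesis using ratio[of n] by (metis mult_pos_pos)
  qed
  have pos: "poly (p n) 1 > 0" for n
  proof (induction n)
    case 0 then show ?case by (simp add: p_def k_def gegenbauer_lead_def)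
  next
    case (Suc n)
    have eq: "poly (p (Suc n)) 1 = (2 * lam + real n) / (lam + real n) / 2 * poly (p n) 1"
      using knz[of n] ln[of n]
      by (simp add: p_def gegenbauer_at_1 rising_coeff_Suc' kS)
    show ?case unfolding eq by (intro mult_pos_pos half_gt_zero ratio Suc)
  qed
  have neg: "(- 1) ^ n * poly (p n) (- 1) > 0" for n
  proof -
    have "(- 1) ^ n * poly (p n) (- 1) = (- 1) ^ n * ((- 1) ^ n * poly (p n) 1)"
      unfolding p_def poly_smult gegenbauer_minus by (simp only: ac_simps)
    then show ?thesis using pos[of n] by (simp only: left_minus_one_mult_self)
  qed
  note interlacing_zeros[of p \<beta>, OF p01 rec \<beta>pos pos neg]
  then obtain X where X: "finite X" "card X = n" "X \<subseteq> {-1<..<1}" "p n = (\<Prod>x\<in>X. [:- x, 1:])"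
    by blast
  have "gegenbauer lam n = smult (k n) (p n)" using knz[of n] by (simp add: p_def)
  with X show ?thesis using that unfolding k_def by metis
qed

section \<open>Interpolation remainder on the Bernstein ellipse\<close>

lemma interpolation_kernel_integrable:
  fixes u :: "complex \<Rightarrow> complex"
  assumes vp: "valid_path \<gamma>" and S: "open S" "u holomorphic_on S" "path_image \<gamma> \<subseteq> S"
    and X: "finite X" "insert x X \<inter> path_image \<gamma> = {}"
  shows "(\<lambda>z. u z / ((\<Prod>a\<in>X. z - a) * (z - x))) contour_integrable_on \<gamma>"
proof (rule contour_integrable_holomorphic_simple[OF _ _ vp])
  let ?T = "S - insert x X"
  show "open ?T" using S(1) X(1) by (intro open_Diff finite_imp_closed) auto
  show "path_image \<gamma> \<subseteq> ?T" using S(3) X(2) by auto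
  show "(\<lambda>z. u z / ((\<Prod>a\<in>X. z - a) * (z - x))) holomorphic_on ?T"
    using X(1) by (intro holomorphic_intros holomorphic_on_subset[OF S(2)]) (auto simp: prod_zero_iff)
qed

text \<open>Induction on the nodes, with Cauchy's formula as the case without nodes. The set
  \<open>A\<close> holds nodes and evaluation points alike, because adding a node needs the
  remainder integral at that node. Vanishing coefficients are demanded instead of a degree bound so
  that the empty node set forces \<open>q = 0\<close>.\<close>

lemma newton_interpolation_remainder:
  fixes u :: "complex \<Rightarrow> complex"
  assumes vp: "valid_path \<gamma>" and S: "open S" "u holomorphic_on S" "path_image \<gamma> \<subseteq> S"
    and A: "A \<inter> path_image \<gamma> = {}"
    and cauchy: "\<And>x. x \<in> A \<Longrightarrow> ((\<lambda>z. u z / (z - x)) has_contour_integral (2 * pi * \<i> * u x)) \<gamma>"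
    and X: "finite X" "X \<subseteq> A"
  shows "\<exists>q. (\<forall>i\<ge>card X. coeff q i = 0) \<and> (\<forall>x\<in>A. 2 * pi * \<i> * (u x - poly q x) =
           (\<Prod>a\<in>X. x - a) * contour_integral \<gamma> (\<lambda>z. u z / ((\<Prod>a\<in>X. z - a) * (z - x))))"
  using X
proof (induction X rule: finite_induct)
  case empty
  show ?case using contour_integral_unique[OF cauchy] by (intro exI[of _ 0]) auto
next
  case (insert b X)
  define P where "P z = (\<Prod>a\<in>X. z - a)" for z
  define F where "F x = contour_integral \<gamma> (\<lambda>z. u z / (P z * (z - x)))" for x
  from insert obtain q where q: "\<And>i. i \<ge> card X \<Longrightarrow> coeff q i = 0"
    "\<And>x. x \<in> A \<Longrightarrow> 2 * pi * \<i> * (u x - poly q x) = P x * F x"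
    unfolding P_def F_def by auto
  have XA: "X \<subseteq> A" "b \<in> A" using insert by auto
  have Pnz: "P z \<noteq> 0" if "z \<notin> A" for z
    using that XA insert.hyps by (auto simp: P_def prod_zero_iff)
  have int: "(\<lambda>z. u z / (P z * (z - x))) contour_integrable_on \<gamma>" if x: "x \<in> A" for x
    unfolding P_def by (rule interpolation_kernel_integrable[OF vp S]) (use insert.hyps XA A x in auto)
  \<comment> \<open>Newton's form: since \<open>(x - b) / ((z - b) (z - x)) = 1 / (z - x) - 1 / (z - b)\<close>, passing to the
    additional node \<open>b\<close> changes the remainder by \<open>P x * F b\<close>.\<close>
  define r where "r = q + smult (F b / (2 * pi * \<i>)) (\<Prod>a\<in>X. [:- a, 1:])"
  have "coeff r i = 0" if "i \<ge> card (insert b X)" for i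
  proof -
    have "degree (\<Prod>a\<in>X. [:- a, 1:]) = card X" by (subst degree_prod_sum_eq) auto
    then have "coeff (\<Prod>a\<in>X. [:- a, 1:]) i = 0"
      using that insert.hyps by (intro coeff_eq_0) simp
    then show ?thesis using that insert.hyps q(1)[of i] by (simp add: r_def)
  qed
  moreover have "2 * pi * \<i> * (u x - poly r x) =
           (\<Prod>a\<in>insert b X. x - a) * contour_integral \<gamma> (\<lambda>z. u z / ((\<Prod>a\<in>insert b X. z - a) * (z - x)))"
    if x: "x \<in> A" for x
  proof -
    have "F x - F b = contour_integral \<gamma> (\<lambda>z. u z / (P z * (z - x)) - u z / (P z * (z - b)))"
      unfolding F_def by (rule contour_integral_diff[symmetric]) (use int x XA in auto)
    also have "\<dots> = contour_integral \<gamma> (\<lambda>z. (x - b) * (u z / ((z - b) * P z * (z - x))))"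
    proof (rule contour_integral_eq)
      fix z assume "z \<in> path_image \<gamma>"
      then have "z \<notin> A" "z \<noteq> b" "z \<noteq> x" using A x XA by auto
      then show "u z / (P z * (z - x)) - u z / (P z * (z - b)) = (x - b) * (u z / ((z - b) * P z * (z - x)))"
        using Pnz[of z] by (simp add: divide_simps) (simp add: algebra_simps)
    qed
    also have "\<dots> = (x - b) * contour_integral \<gamma> (\<lambda>z. u z / ((z - b) * P z * (z - x)))"
    \<comment> \<open>Integrability of the new kernel is recovered by cancelling the constant
      \<open>x - b\<close>; for \<open>x = b\<close> both sides are zero.\<close>
    proof (cases "x = b")
      case False
      have "(\<lambda>z. (x - b) * (u z / ((z - b) * P z * (z - x)))) contour_integrable_on \<gamma>"
      proof (rule contour_integrable_eq)
        show "(\<lambda>z. u z / (P z * (z - x)) - u z / (P z * (z - b))) contour_integrable_on \<gamma>"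
          by (rule contour_integrable_diff) (use int x XA in auto)
        fix z assume "z \<in> path_image \<gamma>"
        then have "z \<notin> A" "z \<noteq> b" "z \<noteq> x" using A x XA by auto
        then show "u z / (P z * (z - x)) - u z / (P z * (z - b)) = (x - b) * (u z / ((z - b) * P z * (z - x)))"
          using Pnz[of z] by (simp add: divide_simps) (simp add: algebra_simps)
      qed
      then have "(\<lambda>z. u z / ((z - b) * P z * (z - x))) contour_integrable_on \<gamma>"
        using False by (subst (asm) contour_integrable_lmul_iff) auto
      then show ?thesis by (rule contour_integral_lmul)
    qed simp
    finally have F: "(x - b) * contour_integral \<gamma> (\<lambda>z. u z / ((z - b) * P z * (z - x))) = F x - F b" ..
    have "poly r x = poly q x + F b / (2 * pi * \<i>) * P x"
      by (simp add: r_def P_def poly_prod)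
    then have "2 * pi * \<i> * (u x - poly r x) = 2 * pi * \<i> * (u x - poly q x) - P x * F b"
      by (simp add: field_simps)
    also have "\<dots> = P x * (F x - F b)" using q(2)[OF x] by (simp add: algebra_simps)
    finally show ?thesis unfolding F[symmetric] using insert.hyps by (simp add: P_def)
  qed
  ultimately show ?case by blast
qed

section \<open>The Joukowski map and the geometry of the ellipse\<close>

definition joukowski :: "complex \<Rightarrow> complex" where
  "joukowski w = (w + inverse w) / 2"

definition ellipse_path :: "real \<Rightarrow> real \<Rightarrow> complex" where
  "ellipse_path \<rho> = joukowski \<circ> circlepath 0 \<rho>"

lemma circlepath_0: "circlepath 0 \<rho> t = of_real \<rho> * exp (\<i> * of_real (2 * pi * t))"
  by (simp add: circlepath mult_ac)

lemma bernstein_ellipse_eq_image: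
  assumes "\<rho> > 0"
  shows "bernstein_ellipse \<rho> = joukowski ` sphere 0 \<rho>"
proof -
  have "(\<lambda>\<theta>. complex_of_real \<rho> * exp (\<i> * complex_of_real \<theta>)) ` {0..2 * pi} = sphere 0 \<rho>"
  proof -
    have "sphere 0 \<rho> = path_image (circlepath 0 \<rho>)" using assms by simp
    also have "\<dots> = (\<lambda>\<theta>. complex_of_real \<rho> * exp (\<i> * complex_of_real \<theta>)) ` ((\<lambda>t. 2 * pi * t) ` {0..1})"
      unfolding path_image_def image_image circlepath_0 ..
    also have "(\<lambda>t. 2 * pi * t) ` {0..1} = {0..2 * pi}"
      by (subst image_mult_atLeastAtMost) auto
    finally show ?thesis ..
  qed
  moreover have "bernstein_ellipse \<rho> = joukowski ` ((\<lambda>\<theta>. complex_of_real \<rho> * exp (\<i> * complex_of_real \<theta>)) ` {0..2 * pi})"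
    unfolding bernstein_ellipse_def joukowski_def image_image by blast
  ultimately show ?thesis by simp
qed

lemma path_image_ellipse_path:
  assumes "\<rho> > 0"
  shows "path_image (ellipse_path \<rho>) = bernstein_ellipse \<rho>"
  using assms by (simp add: ellipse_path_def path_image_compose bernstein_ellipse_eq_image)

lemma joukowski_analytic: "joukowski analytic_on - {0}"
  unfolding joukowski_def [abs_def] by (intro analytic_intros) auto

lemma deriv_joukowski:
  assumes "w \<noteq> 0"
  shows "(joukowski has_field_derivative (1 - inverse (w\<^sup>2)) / 2) (at w)"
  unfolding joukowski_def [abs_def]
  by (rule derivative_eq_intros refl | use assms in \<open>simp add: power2_eq_square\<close>)+

lemma valid_path_ellipse_path:
  assumes "\<rho> > 0"
  shows "valid_path (ellipse_path \<rho>)" "pathfinish (ellipse_path \<rho>) = pathstart (ellipse_path \<rho>)"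
proof -
  show "valid_path (ellipse_path \<rho>)" unfolding ellipse_path_def
    by (rule valid_path_compose_analytic[OF valid_path_circlepath joukowski_analytic])
       (use assms in auto)
  show "pathfinish (ellipse_path \<rho>) = pathstart (ellipse_path \<rho>)"
    by (simp add: ellipse_path_def pathfinish_compose pathstart_compose)
qed

text \<open>A point of the interval is the Joukowski image of \<open>cis (arccos x)\<close> and of
  its conjugate, and these are the two zeros of the numerator of \<open>joukowski w - x\<close>.
  Distance and winding number are both read off from this factorization.\<close>

lemma unit_conjugate_pair:
  assumes "x \<in> {-1..1::real}"
  obtains a b :: complex where "norm a = 1" "norm b = 1"
    "\<And>w. w \<noteq> 0 \<Longrightarrow> joukowski w - of_real x = (w - a) * (w - b) / (2 * w)"
proof -
  define a where "a = cis (arccos x)"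
  have ab: "a * cnj a = 1" unfolding a_def by (simp add: complex_norm_square[symmetric])
  have sum: "a + cnj a = of_real (2 * x)"
    using assms by (simp add: a_def complex_add_cnj cos_arccos)
  show ?thesis
  proof (rule that[of a "cnj a"])
    fix w :: complex assume w: "w \<noteq> 0"
    have "(w - a) * (w - cnj a) = w * w - (a + cnj a) * w + a * cnj a" by (simp add: algebra_simps)
    also have "\<dots> = w * w - of_real (2 * x) * w + 1" unfolding sum ab ..
    finally show "joukowski w - of_real x = (w - a) * (w - cnj a) / (2 * w)"
      using w by (simp add: joukowski_def field_simps)
  qed (auto simp: a_def)
qed

text \<open>Each of the two linear factors has modulus at least \<open>\<rho> - 1\<close>. The bound
  is attained for \<open>w = \<rho>\<close> and \<open>x = 1\<close>.\<close>

lemma joukowski_distance: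
  assumes "x \<in> {-1..1::real}" and \<rho>: "\<rho> > 1" and w: "norm w = \<rho>"
  shows "(\<rho> - 1)\<^sup>2 / (2 * \<rho>) \<le> norm (joukowski w - of_real x)"
proof -
  obtain a b :: complex where ab: "norm a = 1" "norm b = 1"
    and eq: "\<And>w. w \<noteq> 0 \<Longrightarrow> joukowski w - of_real x = (w - a) * (w - b) / (2 * w)"
    using unit_conjugate_pair[OF assms(1)] by metis
  have "w \<noteq> 0" using w \<rho> by auto
  have "\<rho> - 1 \<le> norm (w - a)" "\<rho> - 1 \<le> norm (w - b)"
    using norm_triangle_ineq2[of w a] norm_triangle_ineq2[of w b] w ab by auto
  then have "(\<rho> - 1)\<^sup>2 \<le> norm (w - a) * norm (w - b)"
    unfolding power2_eq_square using \<rho> by (intro mult_mono) auto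
  then show ?thesis
    unfolding eq[OF \<open>w \<noteq> 0\<close>] norm_divide norm_mult w using \<rho> by (simp add: divide_right_mono)
qed

lemma ellipse_avoids_interval:
  assumes "x \<in> {-1..1::real}" "\<rho> > 1"
  shows "complex_of_real x \<notin> bernstein_ellipse \<rho>"
proof
  assume "complex_of_real x \<in> bernstein_ellipse \<rho>"
  then obtain w where "norm w = \<rho>" "joukowski w = of_real x"
    using assms by (auto simp: bernstein_ellipse_eq_image)
  moreover have "0 < (\<rho> - 1)\<^sup>2 / (2 * \<rho>)" using assms by simp
  ultimately show False using joukowski_distance[OF assms, of w] by simp
qed

text \<open>Pulled back to the circle, the integrand becomes the logarithmic derivative
  \<open>1 / (w - a) + 1 / (w - b) - 1 / w\<close>. All three poles lie inside, so the count is 1 +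
  1 - 1.\<close>

lemma winding_number_ellipse:
  assumes "x \<in> {-1..1::real}" and \<rho>: "\<rho> > 1"
  shows "winding_number (ellipse_path \<rho>) (of_real x) = 1"
proof -
  obtain a b :: complex where ab: "norm a = 1" "norm b = 1"
    and eq: "\<And>w. w \<noteq> 0 \<Longrightarrow> joukowski w - of_real x = (w - a) * (w - b) / (2 * w)"
    using unit_conjugate_pair[OF assms(1)] by metis
  let ?c = "circlepath 0 \<rho>"
  have one: "((\<lambda>w. 1 / (w - z)) has_contour_integral 2 * of_real pi * \<i>) ?c" if "norm z < \<rho>" for z
  proof -
    have "z \<notin> path_image ?c" using that \<rho> by auto
    from has_contour_integral_winding_number[OF valid_path_circlepath this]
    show ?thesis using that by (simp add: winding_number_circlepath)
  qed
  have "((\<lambda>w. 1 / (w - a) + 1 / (w - b) - 1 / (w - 0)) has_contour_integral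
      (2 * of_real pi * \<i> + 2 * of_real pi * \<i> - 2 * of_real pi * \<i>)) ?c"
    by (intro has_contour_integral_add has_contour_integral_diff one) (use ab \<rho> in auto)
  then have "((\<lambda>w. deriv joukowski w * (1 / (joukowski w - of_real x))) has_contour_integral
      (2 * of_real pi * \<i> + 2 * of_real pi * \<i> - 2 * of_real pi * \<i>)) ?c"
  proof (rule has_contour_integral_eq)
    fix w assume "w \<in> path_image ?c"
    then have w: "norm w = \<rho>" using \<rho> by simp
    then have nz: "w \<noteq> 0" "w - a \<noteq> 0" "w - b \<noteq> 0" using ab \<rho> by auto
    have e1: "(w - a) * (w - b) = w * w - 2 * of_real x * w + 1"
      using eq[OF nz(1)] nz(1) by (simp add: joukowski_def field_simps)
    have "(w - a) * (w - b) - (w * w - 2 * of_real x * w + 1) = 0" using e1 by simp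
    \<comment> \<open>Evaluating the factorization at 1 and -1 recovers the product and the sum of
      \<open>a\<close> and \<open>b\<close>.\<close>
    moreover have "(1 - a) * (1 - b) = 2 - 2 * of_real x"
      using eq[of 1] by (simp add: joukowski_def field_simps)
    moreover have "(- 1 - a) * (- 1 - b) = 2 + 2 * of_real x"
      using eq[of "-1"] by (simp add: joukowski_def field_simps)
    ultimately have ab1: "a * b = 1" "a + b = 2 * of_real x" by algebra+
    have "1 / (w - a) + 1 / (w - b) - 1 / (w - 0) = (w * w - a * b) / (w * (w - a) * (w - b))"
      using nz by (simp add: divide_simps) (simp add: algebra_simps)
    also have "\<dots> = (w * w - 1) / (w * (w - a) * (w - b))" unfolding ab1 ..
    also have "\<dots> = deriv joukowski w * (1 / (joukowski w - of_real x))"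
      unfolding DERIV_imp_deriv[OF deriv_joukowski[OF nz(1)]] eq[OF nz(1)] using nz
      by (simp add: divide_simps power2_eq_square)
    finally show "1 / (w - a) + 1 / (w - b) - 1 / (w - 0) = deriv joukowski w * (1 / (joukowski w - of_real x))" .
  qed
  then have "contour_integral (ellipse_path \<rho>) (\<lambda>z. 1 / (z - of_real x)) = 2 * of_real pi * \<i>"
    unfolding ellipse_path_def
    using \<rho> by (subst contour_integral_comp_analyticW[OF joukowski_analytic])
                (auto dest: contour_integral_unique)
  moreover have "of_real x \<notin> path_image (ellipse_path \<rho>)"
    using ellipse_avoids_interval[OF assms] \<rho> by (simp add: path_image_ellipse_path)
  ultimately show ?thesis
    using winding_number_valid_path[of "ellipse_path \<rho>" "of_real x"] valid_path_ellipse_path[of \<rho>] \<rho> by simp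
qed

text \<open>The winding number vanishes on the outside, but it is 1 at points of the
  interval.\<close>

lemma interval_inside_ellipse:
  assumes "x \<in> {-1..1::real}" and \<rho>: "\<rho> > 1"
  shows "of_real x \<in> inside (bernstein_ellipse \<rho>)"
proof (rule ccontr)
  assume "of_real x \<notin> inside (bernstein_ellipse \<rho>)"
  then have "of_real x \<in> outside (path_image (ellipse_path \<rho>))"
    using ellipse_avoids_interval[OF assms] \<rho>
    by (simp add: path_image_ellipse_path outside_inside)
  then have "winding_number (ellipse_path \<rho>) (of_real x) = 0"
    using valid_path_ellipse_path[of \<rho>] \<rho>
    by (intro winding_number_zero_in_outside) (auto intro: valid_path_imp_path)
  with winding_number_ellipse[OF assms] show False by simp
qed

lemma ellipse_Cauchy_formula:
  assumes "x \<in> {-1..1::real}" and \<rho>: "\<rho> > 1"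
    and S: "open S" "u holomorphic_on S" "bernstein_ellipse \<rho> \<union> inside (bernstein_ellipse \<rho>) \<subseteq> S"
  shows "((\<lambda>z. u z / (z - of_real x)) has_contour_integral (2 * pi * \<i> * u (of_real x))) (ellipse_path \<rho>)"
proof -
  have vp: "valid_path (ellipse_path \<rho>)" "pathfinish (ellipse_path \<rho>) = pathstart (ellipse_path \<rho>)"
    and im: "path_image (ellipse_path \<rho>) = bernstein_ellipse \<rho>"
    using \<rho> valid_path_ellipse_path[of \<rho>] path_image_ellipse_path[of \<rho>] by auto
  have "winding_number (ellipse_path \<rho>) w = 0" if "w \<notin> S" for w
  proof (rule winding_number_zero_in_outside[OF valid_path_imp_path[OF vp(1)] vp(2)])
    show "w \<in> outside (path_image (ellipse_path \<rho>))"
      using that S(3) unfolding im outside_inside by auto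
  qed
  from Cauchy_integral_formula_global[OF S(1,2) _ vp(1) _ vp(2) this]
  have "((\<lambda>w. u w / (w - of_real x)) has_contour_integral
      (2 * pi * \<i> * winding_number (ellipse_path \<rho>) (of_real x) * u (of_real x))) (ellipse_path \<rho>)"
    using S(3) interval_inside_ellipse[OF assms(1,2)] ellipse_avoids_interval[OF assms(1,2)]
    unfolding im by blast
  then show ?thesis unfolding winding_number_ellipse[OF assms(1,2)] by simp
qed

section \<open>Estimating contour integrals over the ellipse\<close>

lemma ellipse_path_vector_derivative:
  assumes "\<rho> > 0"
  shows "(ellipse_path \<rho> has_vector_derivative
            (pi * \<i> * (\<rho> * cis (2 * pi * t) - cis (- (2 * pi * t)) / \<rho>))) (at t within T)"
proof -
  have "ellipse_path \<rho> = (\<lambda>t. (\<rho> * cis (2 * pi * t) + cis (- (2 * pi * t)) / \<rho>) / 2)"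
    by (rule ext) (simp add: ellipse_path_def joukowski_def circlepath_0 cis_conv_exp
          exp_minus inverse_eq_divide)
  moreover have "((\<lambda>t. (\<rho> * cis (2 * pi * t) + cis (- (2 * pi * t)) / \<rho>) / 2) has_vector_derivative
            (pi * \<i> * (\<rho> * cis (2 * pi * t) - cis (- (2 * pi * t)) / \<rho>))) (at t within T)"
    unfolding cis_conv_exp
    by (rule derivative_eq_intros refl has_vector_derivative_real_field | simp)+ (simp add: algebra_simps)
  ultimately show ?thesis by simp
qed

text \<open>The inequality \<open>2 X s \<le> X\<^sup>2 + s\<^sup>2\<close> bounds the speed by a function whose integral over a period
  is exactly the perimeter bound \<open>s\<close>, so no elliptic integral is needed.\<close>

lemma ellipse_speed_le:
  assumes "\<rho> > 0"
  defines "s \<equiv> pi * sqrt (\<rho>\<^sup>2 + 1 / \<rho>\<^sup>2)"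
  shows "norm (pi * \<i> * (\<rho> * cis \<tau> - cis (- \<tau>) / \<rho>)) \<le> s - pi\<^sup>2 / s * cos (2 * \<tau>)"
proof -
  have s: "s > 0" "s\<^sup>2 = pi\<^sup>2 * (\<rho>\<^sup>2 + 1 / \<rho>\<^sup>2)"
    using assms by (auto simp: s_def power_mult_distrib intro!: mult_pos_pos add_pos_pos)
  define X where "X = norm (pi * \<i> * (\<rho> * cis \<tau> - cis (- \<tau>) / \<rho>))"
  have "X\<^sup>2 = pi\<^sup>2 * (((\<rho> - 1 / \<rho>) * cos \<tau>)\<^sup>2 + ((\<rho> + 1 / \<rho>) * sin \<tau>)\<^sup>2)"
  proof -
    have "Re (\<rho> * cis \<tau> - cis (- \<tau>) / \<rho>) = (\<rho> - 1 / \<rho>) * cos \<tau>"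
      "Im (\<rho> * cis \<tau> - cis (- \<tau>) / \<rho>) = (\<rho> + 1 / \<rho>) * sin \<tau>"
      by (simp_all add: algebra_simps)
    then have "(norm (\<rho> * cis \<tau> - cis (- \<tau>) / \<rho>))\<^sup>2 = ((\<rho> - 1 / \<rho>) * cos \<tau>)\<^sup>2 + ((\<rho> + 1 / \<rho>) * sin \<tau>)\<^sup>2"
      by (simp only: cmod_power2)
    then show ?thesis unfolding X_def norm_mult power_mult_distrib by simp
  qed
  also have "((\<rho> - 1 / \<rho>) * cos \<tau>)\<^sup>2 + ((\<rho> + 1 / \<rho>) * sin \<tau>)\<^sup>2 =
      (\<rho>\<^sup>2 + 1 / \<rho>\<^sup>2) * ((sin \<tau>)\<^sup>2 + (cos \<tau>)\<^sup>2) - 2 * ((cos \<tau>)\<^sup>2 - (sin \<tau>)\<^sup>2)"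
  proof -
    have "((a - q) * c)\<^sup>2 + ((a + q) * e)\<^sup>2 = (a\<^sup>2 + q\<^sup>2) * (e\<^sup>2 + c\<^sup>2) - 2 * (a * q) * (c\<^sup>2 - e\<^sup>2)"
      for a q c e :: real by (simp add: power2_eq_square algebra_simps)
    from this[of \<rho> "1 / \<rho>"] show ?thesis using assms(1) by (simp add: power_one_over)
  qed
  also have "\<dots> = \<rho>\<^sup>2 + 1 / \<rho>\<^sup>2 - 2 * cos (2 * \<tau>)"
    by (simp add: cos_double)
  finally have X2: "X\<^sup>2 = s\<^sup>2 - 2 * pi\<^sup>2 * cos (2 * \<tau>)" using s by (simp add: algebra_simps)
  have "2 * X * s \<le> X\<^sup>2 + s\<^sup>2" by (rule sum_squares_bound)
  then have "X * s \<le> s\<^sup>2 - pi\<^sup>2 * cos (2 * \<tau>)" unfolding X2 by simp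
  then have "X \<le> (s\<^sup>2 - pi\<^sup>2 * cos (2 * \<tau>)) / s" using s by (simp add: pos_le_divide_eq)
  also have "\<dots> = s - pi\<^sup>2 / s * cos (2 * \<tau>)" using s by (simp add: field_simps power2_eq_square)
  finally show ?thesis by (simp add: X_def)
qed

lemma ellipse_contour_integral_bound:
  assumes \<rho>: "\<rho> > 0" and f: "(f has_contour_integral I) (ellipse_path \<rho>)"
    and B: "\<And>z. z \<in> bernstein_ellipse \<rho> \<Longrightarrow> norm (f z) \<le> B"
  shows "norm I \<le> B * (pi * sqrt (\<rho>\<^sup>2 + 1 / \<rho>\<^sup>2))"
proof -
  define s where "s = pi * sqrt (\<rho>\<^sup>2 + 1 / \<rho>\<^sup>2)"
  define d where "d t = pi * \<i> * (\<rho> * cis (2 * pi * t) - cis (- (2 * pi * t)) / \<rho>)" for t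
  define g where "g t = B * (s - pi\<^sup>2 / s * cos (2 * (2 * pi * t)))" for t
  have im: "path_image (ellipse_path \<rho>) = bernstein_ellipse \<rho>" using \<rho> by (rule path_image_ellipse_path)
  have dv: "(ellipse_path \<rho> has_vector_derivative d t) (at t within T)" for t T
    unfolding d_def by (rule ellipse_path_vector_derivative[OF \<rho>])
  have "vector_derivative (ellipse_path \<rho>) (at t within {0..1}) = d t" if "t \<in> {0..1}" for t
    using vector_derivative_within_cbox[of 0 1 t, OF _ _ dv] that by simp
  then have fI: "((\<lambda>t. f (ellipse_path \<rho> t) * d t) has_integral I) {0..1}"
    using f unfolding has_contour_integral_def by (subst has_integral_cong) auto
  have B0: "B \<ge> 0"
  proof -
    have "ellipse_path \<rho> 0 \<in> bernstein_ellipse \<rho>" unfolding im[symmetric] path_image_def by auto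
    from B[OF this] norm_ge_zero show ?thesis by (rule order_trans[rotated])
  qed
  \<comment> \<open>Over \<open>{0..1}\<close> the cosine in \<open>g\<close> runs through two full
    periods, so only the linear part of the antiderivative survives.\<close>
  let ?G = "\<lambda>t. B * (s * t - pi\<^sup>2 / s * (sin (4 * pi * t) / (4 * pi)))"
  have "(g has_integral (?G 1 - ?G 0)) {0..1}"
  proof (rule fundamental_theorem_of_calculus)
    fix t :: real
    show "(?G has_vector_derivative g t) (at t within {0..1})"
      unfolding g_def has_real_derivative_iff_has_vector_derivative[symmetric]
      by (rule derivative_eq_intros refl | simp add: mult.assoc)+
  qed simp
  moreover have "sin (4 * pi) = 0" using sin_npi[of 4] by simp
  ultimately have gI: "(g has_integral B * s) {0..1}" by simp
  have "norm (integral {0..1} (\<lambda>t. f (ellipse_path \<rho> t) * d t)) \<le> integral {0..1} g"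
  proof (rule integral_norm_bound_integral)
    fix t :: real assume t: "t \<in> {0..1}"
    have "ellipse_path \<rho> t \<in> bernstein_ellipse \<rho>" unfolding im[symmetric] path_image_def using t by auto
    then show "norm (f (ellipse_path \<rho> t) * d t) \<le> g t"
      unfolding norm_mult[of "f _"] g_def
      using ellipse_speed_le[OF \<rho>, of "2 * pi * t"]
      by (intro mult_mono B B0 norm_ge_zero) (simp_all add: d_def s_def)
  qed (use fI gI in auto)
  then show ?thesis using fI gI by (simp add: integral_unique s_def)
qed

section \<open>Asymptotics outside the interval\<close>

lemma gt_minus_half_not_nonpos_Int:
  fixes lam :: real
  assumes "lam > -1/2" "lam \<noteq> 0"
  shows "lam \<notin> \<int>\<^sub>\<le>\<^sub>0"
proof
  assume "lam \<in> \<int>\<^sub>\<le>\<^sub>0"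
  then obtain n where "lam = - real n" by (auto elim: nonpos_Ints_cases')
  then show False using assms by (cases n) auto
qed

text \<open>Euler's limit formula for Gamma, inverted: \<open>rising_coeff lam n\<close> is
  asymptotic to \<open>n powr (lam - 1) / Gamma lam\<close>.\<close>

lemma rising_coeff_asymp:
  assumes "lam \<notin> \<int>\<^sub>\<le>\<^sub>0"
  shows "(\<lambda>n. rising_coeff lam n * real n powr (1 - lam)) \<longlonglongrightarrow> 1 / Gamma lam"
proof -
  have "(\<lambda>n. 1 / Gamma_series' lam n) \<longlonglongrightarrow> 1 / Gamma lam"
    by (intro tendsto_intros Gamma_series'_LIMSEQ) (use assms in \<open>simp add: Gamma_eq_zero_iff\<close>)
  moreover have "eventually (\<lambda>n. 1 / Gamma_series' lam n = rising_coeff lam n * real n powr (1 - lam)) sequentially"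
    using eventually_gt_at_top[of 0]
  proof eventually_elim
    case (elim n)
    then have "fact n = real n * fact (n - 1)" by (simp add: fact_reduce)
    moreover have "real n powr (1 - lam) = real n / exp (lam * ln (real n))"
      using elim by (simp add: powr_def left_diff_distrib exp_diff)
    ultimately show ?case using elim by (simp add: rising_coeff_def Gamma_series'_def)
  qed
  ultimately show ?thesis by (rule Lim_transform_eventually)
qed

text \<open>The finitely many terms before monotonicity sets in cost only the quotient of their
  maximum and minimum.\<close>

lemma eventually_mono_imp_quasi_mono:
  fixes b :: "nat \<Rightarrow> real"
  assumes pos: "\<And>n. b n > 0" and mono: "\<And>n. n \<ge> N \<Longrightarrow> b n \<le> b (Suc n)"
  obtains B where "B > 0" "\<And>m n. m \<le> n \<Longrightarrow> b m \<le> B * b n"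
proof
  define C c where "C = Max (b ` {..N})" and "c = Min (b ` {..N})"
  have C: "b n \<le> C" and c: "c \<le> b n" if "n \<le> N" for n
    using that by (auto simp: C_def c_def)
  have cpos: "c > 0" using pos by (auto simp: c_def)
  have Cpos: "C > 0" using C[of N] pos[of N] by simp
  show "C / c > 0" using cpos Cpos by simp
  have incr: "b m \<le> b n" if "N \<le> m" "m \<le> n" for m n
    using that(2,1) by (induction n rule: dec_induct) (auto intro: order_trans[OF _ mono])
  have cb: "c \<le> b n" for n using c[of n] c[of N] incr[of N n] by (cases "n \<le> N") auto
  fix m n :: nat assume mn: "m \<le> n"
  show "b m \<le> C / c * b n"
  proof (cases "m \<le> N")
    case True
    have "b m * c \<le> C * b n" using C[OF True] cb[of n] Cpos cpos by (intro mult_mono) auto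
    then show ?thesis using cpos by (simp add: field_simps)
  next
    case False
    have "1 \<le> C / c" using C[of N] c[of N] cpos by simp
    then have "1 * b n \<le> C / c * b n" using pos[of n] by (intro mult_right_mono) auto
    then show ?thesis using incr[of m n] False mn by simp
  qed
qed

lemma Suc_over_shift_tendsto_1: "(\<lambda>n. real (Suc n) / (lam + real n)) \<longlonglongrightarrow> 1"
  by real_asymp

text \<open>Supplies the domination needed for Tannery's theorem, uniformly in \<open>n\<close>.
  Quotients of consecutive coefficients tend to 1, so the weight \<open>r ^ n\<close> makes the
  absolute values eventually increasing.\<close>

lemma rising_coeff_quasi_mono:
  assumes lam: "lam > -1/2" "lam \<noteq> 0" and r: "r > 1"
  obtains B where "B > 0" "\<And>k n. k \<le> n \<Longrightarrow> \<bar>rising_coeff lam (n - k) / rising_coeff lam n\<bar> \<le> B * r ^ k"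
proof -
  define b where "b n = \<bar>rising_coeff lam n\<bar> * r ^ n" for n
  have nz: "rising_coeff lam n \<noteq> 0" for n by (rule rising_coeff_nonzero[OF lam])
  have pos: "b n > 0" for n using nz r by (simp add: b_def)
  have "eventually (\<lambda>n. real (Suc n) / (lam + real n) < r) sequentially"
    using order_tendstoD(2)[OF Suc_over_shift_tendsto_1 r] .
  then have "eventually (\<lambda>n. real (Suc n) / (lam + real n) < r \<and> n \<ge> 1) sequentially"
    using eventually_ge_at_top by (rule eventually_conj)
  then obtain N where N: "\<And>n. n \<ge> N \<Longrightarrow> real (Suc n) / (lam + real n) < r \<and> n \<ge> 1"
    by (auto simp: eventually_sequentially)
  have "b n \<le> b (Suc n)" if "n \<ge> N" for n
  proof -
    have p: "lam + real n > 0" using N[OF that] lam by simp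
    have "real (Suc n) \<le> r * (lam + real n)" using N[OF that] p by (simp add: pos_divide_less_eq)
    then have "1 \<le> r * ((lam + real n) / real (Suc n))" by (simp add: field_simps)
    then have "b n * 1 \<le> b n * (r * ((lam + real n) / real (Suc n)))"
      using pos[of n] by (intro mult_left_mono) auto
    also have "\<dots> = b (Suc n)" using p by (simp add: b_def rising_coeff_Suc' abs_mult)
    finally show ?thesis by simp
  qed
  then obtain B where B: "B > 0" "\<And>m n. m \<le> n \<Longrightarrow> b m \<le> B * b n"
    using eventually_mono_imp_quasi_mono[of b N] pos by metis
  show ?thesis
  proof (rule that[OF B(1)])
    fix k n :: nat assume k: "k \<le> n"
    have "b (n - k) \<le> B * b n" by (rule B) simp
    moreover have "r ^ n = r ^ k * r ^ (n - k)" using k by (simp flip: power_add)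
    ultimately have "\<bar>rising_coeff lam (n - k)\<bar> * r ^ (n - k) \<le> (B * r ^ k * \<bar>rising_coeff lam n\<bar>) * r ^ (n - k)"
      by (simp add: b_def mult_ac)
    then have "\<bar>rising_coeff lam (n - k)\<bar> \<le> B * r ^ k * \<bar>rising_coeff lam n\<bar>"
      using r by (simp add: mult_le_cancel_right)
    then show "\<bar>rising_coeff lam (n - k) / rising_coeff lam n\<bar> \<le> B * r ^ k"
      using nz[of n] by (simp add: abs_divide pos_divide_le_eq)
  qed
qed

lemma rising_coeff_ratio_tendsto_1:
  assumes lam: "lam > -1/2" "lam \<noteq> 0"
  shows "(\<lambda>n. rising_coeff lam (n - k) / rising_coeff lam n) \<longlonglongrightarrow> 1"
proof -
  have nz: "rising_coeff lam n \<noteq> 0" for n by (rule rising_coeff_nonzero[OF lam])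
  have sh: "lam + real n \<noteq> 0" for n using lam by (cases n) auto
  have "(\<lambda>n. rising_coeff lam n / rising_coeff lam (n + k)) \<longlonglongrightarrow> 1"
  proof (induction k)
    case 0
    show ?case using nz by simp
  next
    case (Suc k)
    have "(\<lambda>n. real (Suc (n + k)) / (lam + real (n + k))) \<longlonglongrightarrow> 1"
      by (rule LIMSEQ_ignore_initial_segment[OF Suc_over_shift_tendsto_1])
    from tendsto_mult[OF Suc this]
    have "(\<lambda>n. rising_coeff lam n / rising_coeff lam (n + k) * (real (Suc (n + k)) / (lam + real (n + k)))) \<longlonglongrightarrow> 1"
      by simp
    moreover have "rising_coeff lam n / rising_coeff lam (n + k) * (real (Suc (n + k)) / (lam + real (n + k)))
       = rising_coeff lam n / rising_coeff lam (n + Suc k)" for n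
      unfolding add_Suc_right rising_coeff_Suc' using sh[of "n + k"] nz[of "n + k"] by simp
    ultimately show ?case by simp
  qed
  then show ?thesis
    by (intro LIMSEQ_offset[of "\<lambda>n. rising_coeff lam (n - k) / rising_coeff lam n" k]) simp
qed

lemma rising_coeff_sums:
  fixes z :: complex
  assumes "norm z < 1"
  shows "(\<lambda>k. of_real (rising_coeff lam k) * z ^ k) sums (1 - z) powr of_real (- lam)"
proof -
  have "(\<lambda>n. (complex_of_real (- lam) gchoose n) * (- z) ^ n) sums (1 + - z) powr of_real (- lam)"
    by (rule gen_binomial_complex) (use assms in simp)
  moreover have "(complex_of_real (- lam) gchoose n) * (- z) ^ n = of_real (rising_coeff lam n) * z ^ n" for n
  proof -
    have "(- z) ^ n = (- 1) ^ n * z ^ n" by (rule power_minus)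
    then show ?thesis
      by (simp add: gbinomial_pochhammer rising_coeff_def pochhammer_of_real mult_ac)
  qed
  ultimately show ?thesis by simp
qed

lemma rising_coeff_abs_summable:
  assumes "0 \<le> q" "q < 1"
  shows "summable (\<lambda>k. \<bar>rising_coeff lam k\<bar> * q ^ k)"
proof -
  obtain p where p: "q < p" "p < 1" using assms(2) dense by blast
  have "summable (\<lambda>k. complex_of_real (rising_coeff lam k) * of_real p ^ k)"
    by (rule sums_summable[OF rising_coeff_sums]) (use p assms in simp)
  from powser_insidea[OF this, of "of_real q"]
  show ?thesis using assms p by (simp add: norm_mult norm_power)
qed

text \<open>The error \<delta> can be chosen independently of \<open>w\<close>: it is a series of
  absolute values, and the modulus of \<open>inverse (w^2)\<close> is constant on the
  circle.\<close>

lemma joukowski_sum_lower_bound: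
  assumes lam: "lam > -1/2" "lam \<noteq> 0" and \<rho>: "\<rho> > 1"
  obtains \<delta> where "\<delta> \<longlonglongrightarrow> 0"
    "\<And>n w. norm w = \<rho> \<Longrightarrow> norm (joukowski_sum lam n w) \<ge>
        \<rho> ^ n * \<bar>rising_coeff lam n\<bar> * (norm (1 - inverse (w\<^sup>2)) powr (- lam) - \<delta> n)"
proof -
  define a where "a = rising_coeff lam"
  \<comment> \<open>The deviation of the coefficient ratio from its limit 1. For
    \<open>k > n\<close> its value -1 cancels the tail of the binomial series, so that below the
    infinite sum collapses to the finite one.\<close>
  define f where "f k n = (if k \<le> n then a (n - k) / a n else 0) - 1" for k n
  define g where "g k n = \<bar>a k\<bar> * \<bar>f k n\<bar> * (1 / \<rho>\<^sup>2) ^ k" for k n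
  have anz: "a n \<noteq> 0" for n unfolding a_def by (rule rising_coeff_nonzero[OF lam])
  \<comment> \<open>Taking the growth rate to be \<rho> spends half of the decay
    \<open>(1 / \<rho>^2) ^ k\<close>; the remaining \<open>(1 / \<rho>) ^ k\<close> still yields a
    summable majorant.\<close>
  obtain B where B: "B > 0" "\<And>k n. k \<le> n \<Longrightarrow> \<bar>a (n - k) / a n\<bar> \<le> B * \<rho> ^ k"
    using rising_coeff_quasi_mono[OF lam \<rho>] unfolding a_def by blast
  have f: "\<bar>f k n\<bar> \<le> (B + 1) * \<rho> ^ k" for k n
  proof -
    have 1: "\<rho> ^ k \<ge> 1" using \<rho> by simp
    have "\<bar>if k \<le> n then a (n - k) / a n else 0\<bar> \<le> B * \<rho> ^ k"
      using B \<rho> by auto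
    then have "\<bar>f k n\<bar> \<le> B * \<rho> ^ k + 1" unfolding f_def by linarith
    also have "\<dots> \<le> (B + 1) * \<rho> ^ k" using 1 by (simp add: algebra_simps)
    finally show ?thesis .
  qed
  have g: "g k n \<le> (B + 1) * (\<bar>a k\<bar> * (1 / \<rho>) ^ k)" for k n
  proof -
    have "g k n \<le> \<bar>a k\<bar> * ((B + 1) * \<rho> ^ k) * (1 / \<rho>\<^sup>2) ^ k"
      unfolding g_def by (intro mult_right_mono mult_left_mono f) auto
    also have "\<rho> ^ k * (1 / \<rho>\<^sup>2) ^ k = (1 / \<rho>) ^ k"
      unfolding power_mult_distrib[symmetric] using \<rho> by (simp add: power2_eq_square)
    then have "\<bar>a k\<bar> * ((B + 1) * \<rho> ^ k) * (1 / \<rho>\<^sup>2) ^ k = (B + 1) * (\<bar>a k\<bar> * (1 / \<rho>) ^ k)"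
      by (simp add: mult_ac)
    finally show ?thesis .
  qed
  have g0: "g k n \<ge> 0" for k n unfolding g_def by simp
  have sum: "summable (\<lambda>k. (B + 1) * (\<bar>a k\<bar> * (1 / \<rho>) ^ k))"
    unfolding a_def by (intro summable_mult rising_coeff_abs_summable) (use \<rho> in auto)
  have gsum: "summable (\<lambda>k. g k n)" for n
    by (rule summable_comparison_test'[OF sum, of 0]) (use g g0 in auto)
  have lim: "(\<lambda>n. g k n) \<longlonglongrightarrow> 0" for k
  proof -
    have "(\<lambda>n. a (n - k) / a n - 1) \<longlonglongrightarrow> 1 - 1"
      unfolding a_def by (intro tendsto_diff rising_coeff_ratio_tendsto_1[OF lam] tendsto_const)
    moreover have "eventually (\<lambda>n. a (n - k) / a n - 1 = f k n) sequentially"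
      using eventually_ge_at_top[of k] by eventually_elim (simp add: f_def)
    ultimately have "(\<lambda>n. f k n) \<longlonglongrightarrow> 0" by (simp add: Lim_transform_eventually)
    then have "(\<lambda>n. \<bar>a k\<bar> * \<bar>f k n\<bar> * (1 / \<rho>\<^sup>2) ^ k) \<longlonglongrightarrow> \<bar>a k\<bar> * \<bar>0\<bar> * (1 / \<rho>\<^sup>2) ^ k"
      by (intro tendsto_intros)
    then show ?thesis by (simp add: g_def)
  qed
  have "((\<lambda>n. \<Sum>k. g k n) \<longlonglongrightarrow> (\<Sum>k. 0))"
  proof (rule tannerys_theorem[OF lim _ sum, THEN conjunct2, THEN conjunct2])
    show "\<forall>\<^sub>F (k, n) in sequentially \<times>\<^sub>F sequentially. norm (g k n) \<le> (B + 1) * (\<bar>a k\<bar> * (1 / \<rho>) ^ k)"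
      by (rule always_eventually) (use g g0 in auto)
  qed simp
  then have "(\<lambda>n. \<Sum>k. g k n) \<longlonglongrightarrow> 0" by simp
  then show ?thesis
  proof (rule that)
    fix n w assume w: "norm (w :: complex) = \<rho>"
    define z where "z = inverse (w\<^sup>2)"
    have wnz: "w \<noteq> 0" using w \<rho> by auto
    have nz: "norm z = 1 / \<rho>\<^sup>2" using w by (simp add: z_def norm_divide norm_power inverse_eq_divide)
    have z1: "norm z < 1" unfolding nz using \<rho> by (simp add: power_less_one_iff)
    define h where "h k = of_real (a k * f k n) * z ^ k" for k
    have nh: "norm (h k) = g k n" for k
      unfolding h_def g_def by (simp add: norm_mult norm_power abs_mult nz)
    have hs: "summable h" by (rule summable_norm_cancel) (simp add: nh gsum)
    have pz: "(\<lambda>k. of_real (a k) * z ^ k) sums (1 - z) powr of_real (- lam)"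
      unfolding a_def by (rule rising_coeff_sums[OF z1])
    have "(\<lambda>k. h k + of_real (a k) * z ^ k) sums (suminf h + (1 - z) powr of_real (- lam))"
      by (intro sums_add pz summable_sums hs)
    moreover have "(\<lambda>k. h k + of_real (a k) * z ^ k) sums (\<Sum>k\<le>n. h k + of_real (a k) * z ^ k)"
      by (rule sums_finite) (auto simp: h_def f_def)
    ultimately have eq: "(\<Sum>k\<le>n. h k + of_real (a k) * z ^ k) = suminf h + (1 - z) powr of_real (- lam)"
      using sums_unique2 by blast
    have "joukowski_sum lam n w = (\<Sum>k\<le>n. w ^ n * of_real (a n) * (h k + of_real (a k) * z ^ k))"
      unfolding joukowski_sum_def
    proof (rule sum.cong)
      fix k assume "k \<in> {..n}"
      then have k: "k \<le> n" by simp
      have p: "inverse w ^ k * w ^ (n - k) = w ^ n * z ^ k"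
      proof -
        have "w ^ n = w ^ (n - k) * w ^ k" using k by (simp flip: power_add)
        moreover have "w * z = inverse w"
          using wnz by (simp add: z_def power2_eq_square field_simps)
        then have "w ^ k * z ^ k = inverse w ^ k" by (metis power_mult_distrib)
        ultimately show ?thesis by simp
      qed
      have "h k + of_real (a k) * z ^ k = of_real (a k * (a (n - k) / a n)) * z ^ k"
        using k by (simp add: h_def f_def algebra_simps)
      then have "w ^ n * of_real (a n) * (h k + of_real (a k) * z ^ k)
          = of_real (a n * (a k * (a (n - k) / a n))) * (w ^ n * z ^ k)" by (simp add: mult_ac)
      also have "a n * (a k * (a (n - k) / a n)) = a k * a (n - k)" using anz[of n] by simp
      finally show "complex_of_real (rising_coeff lam k * rising_coeff lam (n - k)) * inverse w ^ k * w ^ (n - k)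
          = w ^ n * of_real (a n) * (h k + of_real (a k) * z ^ k)"
        unfolding a_def by (simp only: p mult.assoc)
    qed simp
    also have "\<dots> = w ^ n * of_real (a n) * (suminf h + (1 - z) powr of_real (- lam))"
      unfolding eq[symmetric] sum_distrib_left ..
    finally have J: "norm (joukowski_sum lam n w) = \<rho> ^ n * \<bar>a n\<bar> * norm (suminf h + (1 - z) powr of_real (- lam))"
      by (simp add: norm_mult norm_power w)
    have "norm (suminf h) \<le> (\<Sum>k. g k n)"
      using summable_norm[of h] gsum by (simp add: nh)
    moreover have "norm ((1 - z) powr of_real (- lam)) = norm (1 - z) powr (- lam)"
      by (subst norm_powr_real_powr') auto
    moreover have "norm ((1 - z) powr of_real (- lam)) \<le>
        norm (suminf h + (1 - z) powr of_real (- lam)) + norm (suminf h)"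
      by (metis add_diff_cancel_left' norm_triangle_ineq4 add.commute)
    ultimately have "norm (1 - z) powr (- lam) - (\<Sum>k. g k n) \<le> norm (suminf h + (1 - z) powr of_real (- lam))"
      by linarith
    then show "norm (joukowski_sum lam n w) \<ge>
        \<rho> ^ n * \<bar>rising_coeff lam n\<bar> * (norm (1 - inverse (w\<^sup>2)) powr (- lam) - (\<Sum>k. g k n))"
      unfolding J z_def[symmetric] a_def using \<rho> by (intro mult_left_mono) auto
  qed
qed

section \<open>Bounds for Gegenbauer polynomials on the ellipse and the interval\<close>

lemma poly_cpoly_of_real: "poly (cpoly p) (of_real x) = of_real (poly p x)"
  by (induction p) (auto simp: map_poly_pCons)

text \<open>The minimum of \<open>norm (1 - inverse (w^2)) powr (- lam)\<close> over the circle of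
  radius \<rho>. The sign of \<open>lam\<close> decides whether the largest or the smallest modulus
  matters, which is the source of the different signs in the two error bounds.\<close>

definition ellipse_factor :: "real \<Rightarrow> real \<Rightarrow> real" where
  "ellipse_factor lam \<rho> = (if lam > 0 then (1 + 1 / \<rho>\<^sup>2) powr (- lam) else (1 - 1 / \<rho>\<^sup>2) powr (- lam))"

lemma ellipse_factor_pos: "\<rho> > 1 \<Longrightarrow> ellipse_factor lam \<rho> > 0"
proof -
  assume "\<rho> > 1"
  then have "1 < \<rho>\<^sup>2" "1 + 1 / \<rho>\<^sup>2 > 0" by (simp_all add: add_pos_pos)
  then show ?thesis by (auto simp: ellipse_factor_def)
qed

lemma ellipse_factor_le:
  assumes \<rho>: "\<rho> > 1" and w: "norm (w :: complex) = \<rho>"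
  shows "ellipse_factor lam \<rho> \<le> norm (1 - inverse (w\<^sup>2)) powr (- lam)"
proof -
  have n: "norm (inverse (w\<^sup>2)) = 1 / \<rho>\<^sup>2"
    using w by (simp add: norm_divide norm_power inverse_eq_divide)
  have r: "1 / \<rho>\<^sup>2 < 1" using \<rho> by simp
  have "norm (1 - inverse (w\<^sup>2)) \<le> 1 + 1 / \<rho>\<^sup>2" "1 - 1 / \<rho>\<^sup>2 \<le> norm (1 - inverse (w\<^sup>2))"
    using norm_triangle_ineq4[of 1 "inverse (w\<^sup>2)"] norm_triangle_ineq2[of 1 "inverse (w\<^sup>2)"]
    unfolding n by simp_all
  moreover from this r have "0 < norm (1 - inverse (w\<^sup>2))" by linarith
  ultimately show ?thesis
    using r unfolding ellipse_factor_def by (cases "lam > 0") (auto intro: powr_mono2 powr_mono2' simp del: zero_less_norm_iff)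
qed

lemma gegenbauer_complex_factorization:
  assumes lam: "lam > -1/2" "lam \<noteq> 0"
  obtains X where "finite X" "card X = n" "X \<subseteq> {-1<..<1}"
    "\<And>z. poly (cpoly (gegenbauer lam n)) z = of_real (gegenbauer_lead lam n) * (\<Prod>a\<in>of_real ` X. z - a)"
    "{x. poly (gegenbauer lam n) x = 0} = X"
proof -
  obtain X where X: "finite X" "card X = n" "X \<subseteq> {-1<..<1}"
    "gegenbauer lam n = smult (gegenbauer_lead lam n) (\<Prod>x\<in>X. [:- x, 1:])"
    using gegenbauer_factorization[OF lam, of n] by metis
  have k: "gegenbauer_lead lam n \<noteq> 0" using rising_coeff_nonzero[OF lam] by (simp add: gegenbauer_lead_def)
  have "cpoly (\<Prod>x\<in>X. [:- x, 1:]) = (\<Prod>x\<in>X. [:- of_real x, 1:])"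
    using X(1) by (induction X rule: finite_induct) (simp_all add: cpoly_simps map_poly_pCons)
  then have "poly (cpoly (gegenbauer lam n)) z = of_real (gegenbauer_lead lam n) * (\<Prod>x\<in>X. z - of_real x)" for z
    unfolding X(4) cpoly_simps by (simp add: poly_prod)
  moreover have "(\<Prod>a\<in>of_real ` X. z - a) = (\<Prod>x\<in>X. z - of_real x)" for z :: complex
    by (subst prod.reindex) (auto simp: inj_on_def)
  moreover have "{x. poly (gegenbauer lam n) x = 0} = X"
    unfolding X(4) using X(1) k by (auto simp: poly_prod prod_zero_iff)
  ultimately show ?thesis using that[of X] X by simp
qed

lemma compact_bernstein_ellipse:
  assumes "\<rho> > 0"
  shows "compact (bernstein_ellipse \<rho>)" "bernstein_ellipse \<rho> \<noteq> {}"
  using assms valid_path_ellipse_path[OF assms] path_image_ellipse_path[OF assms]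
  by (metis compact_path_image valid_path_imp_path, metis path_image_nonempty)

text \<open>\<open>L n\<close> is the actual minimum over the compact ellipse. It is positive for
  every \<open>n\<close> because the zeros lie in the interval, whereas the asymptotic estimate may
  be negative for small \<open>n\<close>; the final bound has to cover those degrees too.\<close>

lemma gegenbauer_ellipse_lower_bound:
  assumes lam: "lam > -1/2" "lam \<noteq> 0" and \<rho>: "\<rho> > 1"
  obtains L \<delta> where "\<And>n. L n > 0" "\<delta> \<longlonglongrightarrow> 0"
    "\<And>n z. z \<in> bernstein_ellipse \<rho> \<Longrightarrow> L n \<le> norm (poly (cpoly (gegenbauer lam n)) z)"
    "\<And>n. \<rho> ^ n * \<bar>rising_coeff lam n\<bar> * (ellipse_factor lam \<rho> - \<delta> n) \<le> L n"
proof -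
  let ?C = "\<lambda>n z. norm (poly (cpoly (gegenbauer lam n)) z)"
  let ?E = "bernstein_ellipse \<rho>"
  obtain \<delta> where \<delta>: "\<delta> \<longlonglongrightarrow> 0" "\<And>n w. norm w = \<rho> \<Longrightarrow> norm (joukowski_sum lam n w) \<ge>
        \<rho> ^ n * \<bar>rising_coeff lam n\<bar> * (norm (1 - inverse (w\<^sup>2)) powr (- lam) - \<delta> n)"
    using joukowski_sum_lower_bound[OF lam \<rho>] by metis
  have "\<exists>m\<in>?E. \<forall>z\<in>?E. ?C n m \<le> ?C n z" for n
    by (rule continuous_attains_inf) (use compact_bernstein_ellipse[of \<rho>] \<rho> in \<open>auto intro!: continuous_intros\<close>)
  then obtain m where m: "\<And>n. m n \<in> ?E" "\<And>n z. z \<in> ?E \<Longrightarrow> ?C n (m n) \<le> ?C n z" by metis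
  show ?thesis
  proof (rule that[of "\<lambda>n. ?C n (m n)" \<delta>])
    fix n
    obtain X where X: "finite X" "X \<subseteq> {-1<..<1}"
      "\<And>z. poly (cpoly (gegenbauer lam n)) z = of_real (gegenbauer_lead lam n) * (\<Prod>a\<in>of_real ` X. z - a)"
      using gegenbauer_complex_factorization[OF lam, of n] by metis
    have "m n \<notin> of_real ` X"
    proof
      assume "m n \<in> of_real ` X"
      then obtain x where x: "x \<in> X" "m n = of_real x" by auto
      have "x \<in> {-1..1}" using x(1) X(2) by auto
      from ellipse_avoids_interval[OF this \<rho>] show False using m(1)[of n] x(2) by simp
    qed
    then show "?C n (m n) > 0"
      unfolding X(3) using X(1) rising_coeff_nonzero[OF lam] by (auto simp: gegenbauer_lead_def)
    obtain w where w: "norm w = \<rho>" "m n = joukowski w"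
      using m(1)[of n] \<rho> by (auto simp: bernstein_ellipse_eq_image)
    then have "w \<noteq> 0" using \<rho> by auto
    from gegenbauer_joukowski[OF this] have "?C n (m n) = norm (joukowski_sum lam n w)"
      unfolding w joukowski_def by simp
    moreover have "\<rho> ^ n * \<bar>rising_coeff lam n\<bar> * (ellipse_factor lam \<rho> - \<delta> n) \<le>
        \<rho> ^ n * \<bar>rising_coeff lam n\<bar> * (norm (1 - inverse (w\<^sup>2)) powr (- lam) - \<delta> n)"
      using ellipse_factor_le[OF \<rho> w(1)] \<rho> by (intro mult_left_mono) auto
    ultimately show "\<rho> ^ n * \<bar>rising_coeff lam n\<bar> * (ellipse_factor lam \<rho> - \<delta> n) \<le> ?C n (m n)"
      using \<delta>(2)[OF w(1), of n] by linarith
  qed (use \<delta> m in auto)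
qed

text \<open>For positive \<open>lam\<close> all expansion coefficients are nonnegative, so the
  triangle inequality on the unit circle becomes an equality at \<open>w = 1\<close>.\<close>

lemma gegenbauer_bound_pos:
  assumes lam: "lam > 0" and x: "x \<in> {-1..1}"
  shows "\<bar>poly (gegenbauer lam n) x\<bar> \<le> rising_coeff (2 * lam) n"
proof -
  have pos: "rising_coeff lam k \<ge> 0" for k
    using lam by (simp add: rising_coeff_def pochhammer_nonneg)
  define w where "w = cis (arccos x)"
  have w: "norm w = 1" "w \<noteq> 0" by (auto simp: w_def)
  have "(w + inverse w) / 2 = of_real x"
    using x by (simp add: w_def cis_inverse complex_eq_iff)
  then have "\<bar>poly (gegenbauer lam n) x\<bar> = norm (joukowski_sum lam n w)"
    using gegenbauer_joukowski[OF w(2), of lam n] by (metis poly_cpoly_of_real norm_of_real)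
  also have "\<dots> \<le> (\<Sum>k\<le>n. rising_coeff lam k * rising_coeff lam (n - k))"
    unfolding joukowski_sum_def
    by (rule sum_norm_le) (simp add: norm_mult norm_power norm_inverse w pos)
  also have "\<dots> = norm (joukowski_sum lam n 1)"
    by (simp add: joukowski_sum_def pos sum_nonneg flip: of_real_mult of_real_sum)
  also have "\<dots> = \<bar>poly (gegenbauer lam n) 1\<bar>"
    using gegenbauer_joukowski[of 1 lam n] poly_cpoly_of_real[of "gegenbauer lam n" 1] by simp
  also have "\<dots> = rising_coeff (2 * lam) n"
    using lam by (simp add: gegenbauer_at_1) (simp add: rising_coeff_def pochhammer_nonneg)
  finally show ?thesis .
qed

section \<open>The error bound for a fixed degree\<close>

lemma
  fixes u :: "complex \<Rightarrow> complex"
  assumes \<rho>: "\<rho> > 1"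
    and u: "u analytic_on (bernstein_ellipse \<rho> \<union> inside (bernstein_ellipse \<rho>))"
  shows analytic_ellipse_le_sup:
      "z \<in> bernstein_ellipse \<rho> \<Longrightarrow> cmod (u z) \<le> (SUP z\<in>bernstein_ellipse \<rho>. cmod (u z))"
    and analytic_ellipse_sup_nonneg: "0 \<le> (SUP z\<in>bernstein_ellipse \<rho>. cmod (u z))"
proof -
  let ?E = "bernstein_ellipse \<rho>"
  have \<rho>0: "\<rho> > 0" using \<rho> by simp
  have "continuous_on ?E (\<lambda>z. cmod (u z))"
    by (intro continuous_on_norm holomorphic_on_imp_continuous_on analytic_imp_holomorphic
          analytic_on_subset[OF u]) simp
  then have "compact ((\<lambda>z. cmod (u z)) ` ?E)"
    using compact_bernstein_ellipse(1)[OF \<rho>0] by (rule compact_continuous_image)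
  then have bdd: "bdd_above ((\<lambda>z. cmod (u z)) ` ?E)" by (simp add: bounded_imp_bdd_above compact_imp_bounded)
  show le: "cmod (u z) \<le> (SUP z\<in>?E. cmod (u z))" if "z \<in> ?E" for z
    using that bdd by (rule cSUP_upper)
  show "0 \<le> (SUP z\<in>?E. cmod (u z))"
    using compact_bernstein_ellipse(2)[OF \<rho>0] le norm_ge_zero order_trans by blast
qed

text \<open>Keeping \<open>A\<close> and \<open>L\<close> abstract lets both signs of
  \<open>lam\<close> share this estimate. The remainder formula uses the monic node polynomial; its
  leading coefficient cancels between the value at \<open>x\<close> and the value on the
  ellipse.\<close>

lemma gegenbauer_interpolation_error:
  assumes lam: "lam > -1/2" "lam \<noteq> 0" and \<rho>: "\<rho> > 1"
    and u: "u analytic_on (bernstein_ellipse \<rho> \<union> inside (bernstein_ellipse \<rho>))"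
    and A: "\<And>x. x \<in> {-1..1} \<Longrightarrow> \<bar>poly (gegenbauer lam (n + 1)) x\<bar> \<le> A"
    and L: "L > 0" "\<And>z. z \<in> bernstein_ellipse \<rho> \<Longrightarrow> L \<le> norm (poly (cpoly (gegenbauer lam (n + 1))) z)"
  shows "(SUP x\<in>{-1..1::real}. cmod (u (complex_of_real x)
                    - poly (gegenbauer_interp lam n u) (complex_of_real x)))
      \<le> A / L * (SUP z\<in>bernstein_ellipse \<rho>. cmod (u z)) * sqrt (\<rho>\<^sup>2 + 1 / \<rho>\<^sup>2) * \<rho> / (\<rho> - 1)\<^sup>2"
proof -
  let ?E = "bernstein_ellipse \<rho>" and ?\<gamma> = "ellipse_path \<rho>"
  define M where "M = (SUP z\<in>?E. cmod (u z))"
  define k where "k = gegenbauer_lead lam (n + 1)"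
  have \<rho>0: "\<rho> > 0" using \<rho> by simp
  have k: "k \<noteq> 0" using rising_coeff_nonzero[OF lam] by (simp add: k_def gegenbauer_lead_def)
  obtain S where S: "open S" "?E \<union> inside ?E \<subseteq> S" "u holomorphic_on S"
    using u unfolding analytic_on_holomorphic by blast
  have im: "path_image ?\<gamma> = ?E" by (rule path_image_ellipse_path[OF \<rho>0])
  have MB: "norm (u z) \<le> M" if "z \<in> ?E" for z
    unfolding M_def by (rule analytic_ellipse_le_sup[OF \<rho> u that])
  have M0: "M \<ge> 0" unfolding M_def by (rule analytic_ellipse_sup_nonneg[OF \<rho> u])
  obtain X where X: "finite X" "card X = n + 1" "X \<subseteq> {-1<..<1}"
    "\<And>z. poly (cpoly (gegenbauer lam (n + 1))) z = of_real k * (\<Prod>a\<in>of_real ` X. z - a)"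
    "{x. poly (gegenbauer lam (n + 1)) x = 0} = X"
    using gegenbauer_complex_factorization[OF lam, of "n + 1"] unfolding k_def by metis
  define P where "P z = (\<Prod>a\<in>of_real ` X. z - a)" for z :: complex
  have cX: "card (complex_of_real ` X) = n + 1" using X(2) by (simp add: card_image inj_on_def)
  have XI: "of_real ` X \<subseteq> complex_of_real ` {-1..1}" using X(3) by (intro image_mono) auto
  have avoid: "complex_of_real ` {-1..1} \<inter> path_image ?\<gamma> = {}"
    unfolding im using ellipse_avoids_interval[OF _ \<rho>] by blast
  have pS: "path_image ?\<gamma> \<subseteq> S" using im S(2) by simp
  note vp = valid_path_ellipse_path(1)[OF \<rho>0]
  define I where "I x = contour_integral ?\<gamma> (\<lambda>z. u z / (P z * (z - x)))" for x
  have "\<exists>q. (\<forall>i\<ge>card (complex_of_real ` X). coeff q i = 0) \<and>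
      (\<forall>x\<in>complex_of_real ` {-1..1}. 2 * pi * \<i> * (u x - poly q x) = (\<Prod>a\<in>of_real ` X. x - a) *
        contour_integral ?\<gamma> (\<lambda>z. u z / ((\<Prod>a\<in>of_real ` X. z - a) * (z - x))))"
    by (rule newton_interpolation_remainder[OF vp S(1,3) pS avoid _ _ XI])
       (use X(1) ellipse_Cauchy_formula[OF _ \<rho> S(1,3,2)] in auto)
  then obtain q where q1: "\<forall>i\<ge>n + 1. coeff q i = 0"
    and q2: "\<forall>x\<in>complex_of_real ` {-1..1}. 2 * pi * \<i> * (u x - poly q x) = P x * I x"
    unfolding cX I_def P_def by blast
  have q: "\<And>i. i \<ge> n + 1 \<Longrightarrow> coeff q i = 0"
    "\<And>x. x \<in> {-1..1} \<Longrightarrow> 2 * pi * \<i> * (u (of_real x) - poly q (of_real x)) = P (of_real x) * I (of_real x)"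
    using q1 q2 by blast+
  have interp: "gegenbauer_interp lam n u = q"
    unfolding gegenbauer_interp_def gegenbauer_points_def X(5)
  \<comment> \<open>The difference of two candidates has degree at most \<open>n\<close> and
    vanishes at \<open>n + 1\<close> distinct nodes, so the definite description denotes
    \<open>q\<close>.\<close>
  proof (rule the_equality)
    have dq: "degree q \<le> n" using q(1) by (intro degree_le) auto
    have q0: "poly q (of_real x) = u (of_real x)" if "x \<in> X" for x
    proof -
      have "P (of_real x) = 0" using that X(1) by (auto simp: P_def prod_zero_iff)
      moreover have "x \<in> {-1..1}" using that X(3) by auto
      ultimately show ?thesis using q(2)[of x] by simp
    qed
    show "degree q \<le> n \<and> (\<forall>x\<in>X. poly q (of_real x) = u (of_real x))" using dq q0 by blast
    fix p assume p: "degree p \<le> n \<and> (\<forall>x\<in>X. poly p (of_real x) = u (of_real x))"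
    show "p = q"
    proof (rule ccontr)
      assume "p \<noteq> q"
      then have ne: "p - q \<noteq> 0" by simp
      have "of_real ` X \<subseteq> {z. poly (p - q) z = 0}" using p q0 by auto
      then have "n + 1 \<le> card {z. poly (p - q) z = 0}"
        unfolding cX[symmetric] using ne by (intro card_mono poly_roots_finite) auto
      also have "\<dots> \<le> degree (p - q)" by (rule card_poly_roots_bound[OF ne])
      also have "\<dots> \<le> n" using p dq by (intro degree_diff_le) auto
      finally show False by simp
    qed
  qed
  define d where "d = (\<rho> - 1)\<^sup>2 / (2 * \<rho>)"
  have d: "d > 0" using \<rho> by (simp add: d_def)
  have bound: "norm (u (of_real x) - poly q (of_real x)) \<le> A / L * M * sqrt (\<rho>\<^sup>2 + 1 / \<rho>\<^sup>2) * \<rho> / (\<rho> - 1)\<^sup>2"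
    if x: "x \<in> {-1..1}" for x
  proof -
    have "(\<lambda>z. u z / (P z * (z - of_real x))) contour_integrable_on ?\<gamma>"
      unfolding P_def
      by (rule interpolation_kernel_integrable[OF vp S(1,3) pS]) (use X(1) XI avoid imageI[OF x, of complex_of_real] in blast)+
    then have "((\<lambda>z. u z / (P z * (z - of_real x))) has_contour_integral I (of_real x)) ?\<gamma>"
      unfolding I_def by (rule has_contour_integral_integral)
    then have I: "norm (I (of_real x)) \<le> (M * \<bar>k\<bar> / (L * d)) * (pi * sqrt (\<rho>\<^sup>2 + 1 / \<rho>\<^sup>2))"
    proof (rule ellipse_contour_integral_bound[OF \<rho>0])
      fix z assume z: "z \<in> ?E"
      then obtain w where w: "norm w = \<rho>" "z = joukowski w" using \<rho>0 by (auto simp: bernstein_ellipse_eq_image)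
      have "d \<le> norm (z - of_real x)" unfolding w(2) d_def by (rule joukowski_distance[OF x \<rho> w(1)])
      moreover have "L / \<bar>k\<bar> \<le> norm (P z)"
        using L(2)[OF z] k unfolding X(4) P_def[symmetric] by (simp add: norm_mult pos_divide_le_eq mult.commute)
      ultimately have "L / \<bar>k\<bar> * d \<le> norm (P z) * norm (z - of_real x)"
        using d L(1) k by (intro mult_mono) auto
      then have "norm (u z) / (norm (P z) * norm (z - of_real x)) \<le> M / (L / \<bar>k\<bar> * d)"
        using MB[OF z] M0 d L(1) k by (intro frac_le) auto
      then show "norm (u z / (P z * (z - of_real x))) \<le> M * \<bar>k\<bar> / (L * d)"
        by (simp add: norm_divide norm_mult)
    qed
    have Px: "\<bar>k\<bar> * norm (P (of_real x)) \<le> A"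
      using A[OF x] X(4)[of "of_real x"] unfolding poly_cpoly_of_real P_def[symmetric]
      by (metis norm_mult norm_of_real)
    have "2 * pi * norm (u (of_real x) - poly q (of_real x)) = norm (P (of_real x)) * norm (I (of_real x))"
      using arg_cong[OF q(2)[OF x], of norm] by (simp add: norm_mult)
    also have "\<dots> \<le> norm (P (of_real x)) * ((M * \<bar>k\<bar> / (L * d)) * (pi * sqrt (\<rho>\<^sup>2 + 1 / \<rho>\<^sup>2)))"
      by (intro mult_left_mono I) auto
    also have "\<dots> = (\<bar>k\<bar> * norm (P (of_real x))) * (M / (L * d) * (pi * sqrt (\<rho>\<^sup>2 + 1 / \<rho>\<^sup>2)))"
      by simp
    also have "\<dots> \<le> A * (M / (L * d) * (pi * sqrt (\<rho>\<^sup>2 + 1 / \<rho>\<^sup>2)))"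
      by (intro mult_right_mono Px) (use M0 L(1) d in auto)
    also have "\<dots> = 2 * pi * (A / L * M * sqrt (\<rho>\<^sup>2 + 1 / \<rho>\<^sup>2) * \<rho> / (\<rho> - 1)\<^sup>2)"
      using \<rho> by (simp add: d_def)
    finally show ?thesis by (rule mult_left_le_imp_le) simp
  qed
  show ?thesis unfolding interp M_def[symmetric] by (rule cSUP_least) (use bound in auto)
qed

section \<open>Error bounds\<close>

text \<open>An upper estimate of \<open>K\<close> suffices: the maximum with 1 supplies both
  positivity and the missing lower half of the limit.\<close>

lemma ex_majorant_tendsto_1:
  fixes K :: "nat \<Rightarrow> real"
  assumes "\<And>e. e > 0 \<Longrightarrow> eventually (\<lambda>n. K n < 1 + e) sequentially"
  obtains c where "\<And>n. c n > 0" "c \<longlonglongrightarrow> 1" "\<And>n. K n \<le> c n"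
proof (rule that[of "\<lambda>n. max 1 (K n)"])
  show "(\<lambda>n. max 1 (K n)) \<longlonglongrightarrow> 1"
  proof (rule order_tendstoI)
    fix a :: real assume "a > 1"
    then show "eventually (\<lambda>n. max 1 (K n) < a) sequentially"
      using assms[of "a - 1"] by (auto elim: eventually_mono)
  qed (auto intro!: always_eventually)
qed auto

lemma shifted_powr_ratio:
  shows "(\<lambda>n. (real (n + 1) / real n) powr lam) \<longlonglongrightarrow> 1"
proof -
  have "(\<lambda>n. real (n + 1) / real n) \<longlonglongrightarrow> 1" by real_asymp
  from tendsto_powr[OF this tendsto_const[of lam]] show ?thesis by simp
qed

lemma gegenbauer_error_constant_pos:
  assumes lam: "lam > 0" and \<rho>: "\<rho> > 1"
  obtains c where "\<And>n. c n > 0" "c \<longlonglongrightarrow> 1"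
    "\<And>n u. \<lbrakk>n \<ge> 1; u analytic_on (bernstein_ellipse \<rho> \<union> inside (bernstein_ellipse \<rho>))\<rbrakk> \<Longrightarrow>
      (SUP x\<in>{-1..1::real}. cmod (u (complex_of_real x) - poly (gegenbauer_interp lam n u) (complex_of_real x)))
      \<le> c n * Gamma lam * (SUP z\<in>bernstein_ellipse \<rho>. cmod (u z)) * sqrt (\<rho>^2 + 1 / \<rho>^2)
                 / (Gamma (2 * lam) * (\<rho> - 1)^2 * (1 + 1 / \<rho>^2) powr (-lam))
                * (real n powr lam / \<rho>^n)"
proof -
  have lam': "lam > -1/2" "lam \<noteq> 0" using lam by auto
  have ni: "lam \<notin> \<int>\<^sub>\<le>\<^sub>0" "2 * lam \<notin> \<int>\<^sub>\<le>\<^sub>0" using lam by (auto dest: nonpos_Ints_nonpos)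
  define G1 G2 m where "G1 = Gamma lam" and "G2 = Gamma (2 * lam)" and "m = ellipse_factor lam \<rho>"
  have G: "G1 > 0" "G2 > 0" using lam by (auto simp: G1_def G2_def Gamma_real_pos)
  have m: "m > 0" unfolding m_def by (rule ellipse_factor_pos[OF \<rho>])
  have m_eq: "m = (1 + 1 / \<rho>^2) powr (-lam)" using lam by (simp add: m_def ellipse_factor_def)
  define a b where "a = rising_coeff lam" and "b = rising_coeff (2 * lam)"
  have ab: "a n > 0" "b n > 0" for n using lam by (auto simp: a_def b_def rising_coeff_def pochhammer_pos)
  obtain L \<delta> where L: "\<And>n. L n > 0" "\<delta> \<longlonglongrightarrow> 0"
    "\<And>n z. z \<in> bernstein_ellipse \<rho> \<Longrightarrow> L n \<le> norm (poly (cpoly (gegenbauer lam n)) z)"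
    "\<And>n. \<rho> ^ n * \<bar>a n\<bar> * (m - \<delta> n) \<le> L n"
    using gegenbauer_ellipse_lower_bound[OF lam' \<rho>] unfolding a_def m_def by metis
  \<comment> \<open>The proved bound divided by the claimed one; the maximum of \<open>u\<close> and
    the common geometric factors have cancelled.\<close>
  define K where "K n = b (n + 1) / L (n + 1) * \<rho> * (G2 * m / G1) / (real n powr lam / \<rho> ^ n)" for n
  \<comment> \<open>\<open>K\<close> with \<open>L\<close> replaced by its asymptotic lower bound,
    arranged so that every factor has a known limit. The claim has \<open>n\<close> where the
    polynomial has index \<open>n + 1\<close>, hence the factor
    \<open>((n + 1) / n) powr lam\<close>.\<close>
  define h where "h n = (b (n + 1) * real (n + 1) powr (1 - 2 * lam)) / (a (n + 1) * real (n + 1) powr (1 - lam))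
      * (real (n + 1) / real n) powr lam * (G2 * m / G1) / (m - \<delta> (n + 1))" for n
  have "h \<longlonglongrightarrow> ((1 / G2) / (1 / G1)) * 1 * (G2 * m / G1) / (m - 0)"
    unfolding h_def
  proof (intro tendsto_divide tendsto_mult tendsto_const tendsto_diff shifted_powr_ratio)
    show "(\<lambda>n. b (n + 1) * real (n + 1) powr (1 - 2 * lam)) \<longlonglongrightarrow> 1 / G2"
      unfolding b_def G2_def by (rule LIMSEQ_ignore_initial_segment[OF rising_coeff_asymp[OF ni(2)]])
    show "(\<lambda>n. a (n + 1) * real (n + 1) powr (1 - lam)) \<longlonglongrightarrow> 1 / G1"
      unfolding a_def G1_def by (rule LIMSEQ_ignore_initial_segment[OF rising_coeff_asymp[OF ni(1)]])
    show "(\<lambda>n. \<delta> (n + 1)) \<longlonglongrightarrow> 0" by (rule LIMSEQ_ignore_initial_segment[OF L(2)])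
  qed (use G m in auto)
  then have h1: "h \<longlonglongrightarrow> 1" using G m by simp
  have "eventually (\<lambda>n. \<delta> (n + 1) < m) sequentially"
    by (rule order_tendstoD(2)[OF LIMSEQ_ignore_initial_segment[OF L(2)] m])
  with eventually_gt_at_top[of 0] have Kh: "eventually (\<lambda>n. K n \<le> h n) sequentially"
  proof eventually_elim
    case (elim n)
    have "b (n + 1) / L (n + 1) \<le> b (n + 1) / (\<rho> ^ (n + 1) * a (n + 1) * (m - \<delta> (n + 1)))"
      using L(1)[of "n + 1"] L(4)[of "n + 1"] ab(2)[of "n + 1"] ab(1)[of "n + 1"] elim \<rho>
      by (intro divide_left_mono mult_pos_pos) auto
    then have "K n \<le> b (n + 1) / (\<rho> ^ (n + 1) * a (n + 1) * (m - \<delta> (n + 1))) * \<rho> * (G2 * m / G1) / (real n powr lam / \<rho> ^ n)"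
      unfolding K_def using \<rho> G m by (intro divide_right_mono mult_right_mono) auto
    also have "\<dots> = b (n + 1) / a (n + 1) * (G2 * m / G1) / real n powr lam / (m - \<delta> (n + 1))"
      using \<rho> by simp
    also have "\<dots> = h n"
    proof -
      have "real (n + 1) powr (1 - lam) = real (n + 1) powr (1 - 2 * lam) * real (n + 1) powr lam"
        by (simp flip: powr_add)
      moreover have "(real (n + 1) / real n) powr lam = real (n + 1) powr lam / real n powr lam"
        by (rule powr_divide)
      moreover have "real (n + 1) powr lam > 0" "real (n + 1) powr (1 - 2 * lam) > 0" by simp_all
      ultimately show ?thesis unfolding h_def by (simp del: of_nat_add)
    qed
    finally show ?case .
  qed
  have "eventually (\<lambda>n. K n < 1 + e) sequentially" if "e > 0" for e
    using Kh order_tendstoD(2)[OF h1, of "1 + e"] that by (auto elim: eventually_elim2)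
  then obtain c where c: "\<And>n. c n > 0" "c \<longlonglongrightarrow> 1" "\<And>n. K n \<le> c n"
    using ex_majorant_tendsto_1 by metis
  show ?thesis
  proof (rule that[OF c(1,2)])
    fix n :: nat and u assume n: "n \<ge> 1" and u: "u analytic_on (bernstein_ellipse \<rho> \<union> inside (bernstein_ellipse \<rho>))"
    define M where "M = (SUP z\<in>bernstein_ellipse \<rho>. cmod (u z))"
    define W where "W = sqrt (\<rho>^2 + 1 / \<rho>^2) / (\<rho> - 1)^2"
    have M: "M \<ge> 0" unfolding M_def using analytic_ellipse_sup_nonneg[OF \<rho> u] .
    have W: "W \<ge> 0" by (simp add: W_def)
    have "(SUP x\<in>{-1..1::real}. cmod (u (complex_of_real x) - poly (gegenbauer_interp lam n u) (complex_of_real x)))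
      \<le> b (n + 1) / L (n + 1) * M * sqrt (\<rho>\<^sup>2 + 1 / \<rho>\<^sup>2) * \<rho> / (\<rho> - 1)\<^sup>2"
      unfolding M_def b_def
      by (rule gegenbauer_interpolation_error[OF lam' \<rho> u gegenbauer_bound_pos[OF lam] L(1,3)])
    also have "\<dots> = K n * (M * W * (G1 / (G2 * m)) * (real n powr lam / \<rho> ^ n))"
      unfolding K_def W_def using G m \<rho> n by (simp add: field_simps)
    also have "\<dots> \<le> c n * (M * W * (G1 / (G2 * m)) * (real n powr lam / \<rho> ^ n))"
      using c(3) M W G m \<rho> by (intro mult_right_mono) auto
    also have "\<dots> = c n * G1 * M * sqrt (\<rho>^2 + 1 / \<rho>^2) / (G2 * (\<rho> - 1)^2 * m) * (real n powr lam / \<rho>^n)"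
      by (simp add: W_def mult_ac)
    finally show "(SUP x\<in>{-1..1::real}. cmod (u (complex_of_real x) - poly (gegenbauer_interp lam n u) (complex_of_real x)))
      \<le> c n * Gamma lam * (SUP z\<in>bernstein_ellipse \<rho>. cmod (u z)) * sqrt (\<rho>^2 + 1 / \<rho>^2)
                 / (Gamma (2 * lam) * (\<rho> - 1)^2 * (1 + 1 / \<rho>^2) powr (-lam))
                * (real n powr lam / \<rho>^n)"
      unfolding G1_def G2_def m_eq M_def .
  qed
qed

section \<open>Negative parameters and the choice of the envelope constant\<close>

definition gegenbauer_envelope :: "real \<Rightarrow> real \<Rightarrow> bool" where
  "gegenbauer_envelope lam D \<longleftrightarrow> D > 0 \<and> (\<forall>\<^sub>F k in sequentially. \<forall>x\<in>{-1..1::real}.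
                \<bar>poly (gegenbauer lam k) x\<bar> \<le> D * real k powr (lam - 1))"

text \<open>Keeps the infimum of the admissible constants away from 0. Even indices at
  \<open>x = 0\<close> give \<open>\<bar>rising_coeff lam m\<bar>\<close>, whose asymptotics are
  known; replacing \<open>2 * m\<close> by \<open>m\<close> in the negative power loses a factor
  that is of no importance for positivity.\<close>

lemma gegenbauer_envelope_ge:
  assumes lam: "lam > -1/2" "lam < 0" and D: "gegenbauer_envelope lam D"
  shows "D \<ge> 1 / \<bar>Gamma lam\<bar>"
proof -
  have ni: "lam \<notin> \<int>\<^sub>\<le>\<^sub>0" using lam by (intro gt_minus_half_not_nonpos_Int) auto
  have "filterlim (\<lambda>m. 2 * m) at_top (sequentially)"
    by (rule filterlim_subseq) (auto simp: strict_mono_def)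
  from eventually_compose_filterlim[OF conjunct2[OF D[unfolded gegenbauer_envelope_def]] this]
  have "eventually (\<lambda>m. \<bar>rising_coeff lam m * real m powr (1 - lam)\<bar> \<le> D) sequentially"
    using eventually_gt_at_top[of 0]
  proof eventually_elim
    case (elim m)
    have "\<bar>rising_coeff lam m\<bar> \<le> D * real (2 * m) powr (lam - 1)"
      using bspec[OF elim(1), of 0] by (simp add: gegenbauer_at_0)
    also have "\<dots> \<le> D * real m powr (lam - 1)"
      using D lam elim(2) by (intro mult_left_mono powr_mono2') (auto simp: gegenbauer_envelope_def)
    finally have "\<bar>rising_coeff lam m\<bar> * real m powr (1 - lam) \<le> D * real m powr (lam - 1) * real m powr (1 - lam)"
      by (rule mult_right_mono) simp
    also have "\<dots> = D" using elim(2) by (simp add: mult.assoc flip: powr_add)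
    finally show ?case by (simp add: abs_mult)
  qed
  moreover have "(\<lambda>m. \<bar>rising_coeff lam m * real m powr (1 - lam)\<bar>) \<longlonglongrightarrow> \<bar>1 / Gamma lam\<bar>"
    by (intro tendsto_rabs rising_coeff_asymp ni)
  ultimately have "\<bar>1 / Gamma lam\<bar> \<le> D"
    by (intro tendsto_upperbound) auto
  then show ?thesis by simp
qed

lemma gegenbauer_error_constant_neg:
  assumes lam: "lam > -1/2" "lam < 0" and \<rho>: "\<rho> > 1"
  obtains c where "\<And>n. c n > 0" "c \<longlonglongrightarrow> 1"
    "\<And>n u D. \<lbrakk>n \<ge> 1; u analytic_on (bernstein_ellipse \<rho> \<union> inside (bernstein_ellipse \<rho>)); gegenbauer_envelope lam D\<rbrakk> \<Longrightarrow>
      (SUP x\<in>{-1..1::real}. cmod (u (complex_of_real x) - poly (gegenbauer_interp lam n u) (complex_of_real x)))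
      \<le> c n * D * \<bar>Gamma lam\<bar> * (SUP z\<in>bernstein_ellipse \<rho>. cmod (u z)) * sqrt (\<rho>^2 + 1 / \<rho>^2)
                   / ((\<rho> - 1)^2 * (1 - 1 / \<rho>^2) powr (-lam))
                  * (1 / \<rho>^n)"
proof (cases "\<exists>D. gegenbauer_envelope lam D")
  \<comment> \<open>Without an admissible constant the claim is vacuous, so any sequence tending to
    1 will do.\<close>
  case False
  then show ?thesis using that[of "\<lambda>_. 1"] by auto
next
  case True
  have lam': "lam > -1/2" "lam \<noteq> 0" using lam by auto
  have ni: "lam \<notin> \<int>\<^sub>\<le>\<^sub>0" using lam by (intro gt_minus_half_not_nonpos_Int) auto
  define G m where "G = \<bar>Gamma lam\<bar>" and "m = ellipse_factor lam \<rho>"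
  have G: "G > 0" using ni by (simp add: G_def Gamma_eq_zero_iff)
  have m: "m > 0" unfolding m_def by (rule ellipse_factor_pos[OF \<rho>])
  have m_eq: "m = (1 - 1 / \<rho>^2) powr (-lam)" using lam by (simp add: m_def ellipse_factor_def)
  \<comment> \<open>The error constant must not depend on the envelope constant \<open>D\<close>, so it is built from the
    infimum of all admissible ones.\<close>
  define D0 where "D0 = Inf {D. gegenbauer_envelope lam D}"
  have bdd: "bdd_below {D. gegenbauer_envelope lam D}"
    using gegenbauer_envelope_ge[OF lam] by (intro bdd_belowI[of _ "1 / \<bar>Gamma lam\<bar>"]) auto
  have D0_ge: "D0 \<ge> 1 / G" unfolding D0_def G_def
    using True gegenbauer_envelope_ge[OF lam] by (intro cInf_greatest) auto
  have D0: "D0 > 0" by (rule less_le_trans[OF _ D0_ge]) (use G in simp)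
  \<comment> \<open>The exact maximum on the interval does not depend on \<open>D\<close>, and
    neither will \<open>K\<close>.\<close>
  define S where "S n = (SUP x\<in>{-1..1::real}. \<bar>poly (gegenbauer lam n) x\<bar>)" for n
  have S: "\<bar>poly (gegenbauer lam n) x\<bar> \<le> S n" if "x \<in> {-1..1}" for n x
  proof -
    have "compact ((\<lambda>x. \<bar>poly (gegenbauer lam n) x\<bar>) ` {-1..1})"
      by (intro compact_continuous_image continuous_intros) auto
    then have "bdd_above ((\<lambda>x. \<bar>poly (gegenbauer lam n) x\<bar>) ` {-1..1})"
      by (simp add: bounded_imp_bdd_above compact_imp_bounded)
    with that show ?thesis unfolding S_def by (rule cSUP_upper)
  qed
  have S0: "S n \<ge> 0" for n using S[of 0 n] by simp
  define a where "a n = \<bar>rising_coeff lam n\<bar>" for n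
  have a: "a n > 0" for n using rising_coeff_nonzero[OF lam'] by (simp add: a_def)
  obtain L \<delta> where L: "\<And>n. L n > 0" "\<delta> \<longlonglongrightarrow> 0"
    "\<And>n z. z \<in> bernstein_ellipse \<rho> \<Longrightarrow> L n \<le> norm (poly (cpoly (gegenbauer lam n)) z)"
    "\<And>n. \<rho> ^ n * a n * (m - \<delta> n) \<le> L n"
    using gegenbauer_ellipse_lower_bound[OF lam' \<rho>] unfolding a_def m_def by metis
  define K where "K n = S (n + 1) / L (n + 1) * \<rho> * \<rho> ^ n * m / (D0 * G)" for n
  define h where "h n = 1 / (a (n + 1) * real (n + 1) powr (1 - lam)) * m / G / (m - \<delta> (n + 1))" for n
  have "h \<longlonglongrightarrow> 1 / (1 / G) * m / G / (m - 0)"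
    unfolding h_def
  proof (intro tendsto_divide tendsto_mult[OF tendsto_divide] tendsto_const tendsto_diff)
    have "(\<lambda>n. \<bar>rising_coeff lam n * real n powr (1 - lam)\<bar>) \<longlonglongrightarrow> \<bar>1 / Gamma lam\<bar>"
      by (intro tendsto_rabs rising_coeff_asymp ni)
    then have "(\<lambda>n. a n * real n powr (1 - lam)) \<longlonglongrightarrow> 1 / G"
      by (simp add: a_def G_def abs_mult)
    then show "(\<lambda>n. a (n + 1) * real (n + 1) powr (1 - lam)) \<longlonglongrightarrow> 1 / G"
      by (rule LIMSEQ_ignore_initial_segment)
    show "(\<lambda>n. \<delta> (n + 1)) \<longlonglongrightarrow> 0" by (rule LIMSEQ_ignore_initial_segment[OF L(2)])
  qed (use G m in auto)
  then have h1: "h \<longlonglongrightarrow> 1" using G m by simp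
  have ev\<delta>: "eventually (\<lambda>n. \<delta> (n + 1) < m) sequentially"
    by (rule order_tendstoD(2)[OF LIMSEQ_ignore_initial_segment[OF L(2)] m])
  have Kh: "eventually (\<lambda>n. K n \<le> D / D0 * h n) sequentially" if D: "gegenbauer_envelope lam D" for D
  proof -
    have "eventually (\<lambda>n. \<forall>x\<in>{-1..1}. \<bar>poly (gegenbauer lam (n + 1)) x\<bar> \<le> D * real (n + 1) powr (lam - 1)) sequentially"
      by (rule eventually_sequentially_seg[THEN iffD2]) (use D in \<open>simp add: gegenbauer_envelope_def\<close>)
    with ev\<delta> show ?thesis
    proof eventually_elim
      case (elim n)
      let ?d = "\<rho> ^ (n + 1) * a (n + 1) * (m - \<delta> (n + 1))"
      have d: "?d > 0" using \<rho> a[of "n + 1"] elim(1) by (intro mult_pos_pos) auto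
      have "S (n + 1) \<le> D * real (n + 1) powr (lam - 1)"
        unfolding S_def by (rule cSUP_least) (use elim(2) in auto)
      then have "S (n + 1) / L (n + 1) \<le> D * real (n + 1) powr (lam - 1) / ?d"
        using L(4)[of "n + 1"] d S0[of "n + 1"] by (intro frac_le) auto
      then have "S (n + 1) / L (n + 1) * (\<rho> * \<rho> ^ n * m / (D0 * G))
          \<le> D * real (n + 1) powr (lam - 1) / ?d * (\<rho> * \<rho> ^ n * m / (D0 * G))"
        by (rule mult_right_mono) (use \<rho> m D0 G in auto)
      also have "\<dots> = D / D0 * (real (n + 1) powr (lam - 1) / a (n + 1) * m / G / (m - \<delta> (n + 1)))"
        using \<rho> by simp
      also have "real (n + 1) powr (lam - 1) = 1 / real (n + 1) powr (1 - lam)"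
        by (simp add: powr_minus_divide[symmetric] del: of_nat_add)
      finally show ?case unfolding K_def h_def by (simp add: mult_ac del: of_nat_add)
    qed
  qed
  have "eventually (\<lambda>n. K n < 1 + e) sequentially" if e: "e > 0" for e
  proof -
    \<comment> \<open>The infimum itself is not claimed to be admissible; an admissible
      \<open>D\<close> with \<open>D / D0\<close> below \<open>1 + e\<close> is enough to bound
      \<open>K\<close> eventually.\<close>
    have "D0 < D0 * (1 + e)" using D0 e by simp
    then obtain D where D: "gegenbauer_envelope lam D" "D < D0 * (1 + e)"
      using True unfolding D0_def by (subst (asm) cInf_less_iff[OF _ bdd]) auto
    have "D / D0 < 1 + e" using D(2) D0 by (simp add: pos_divide_less_eq mult.commute)
    moreover have "(\<lambda>n. D / D0 * h n) \<longlonglongrightarrow> D / D0 * 1" by (intro tendsto_intros h1)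
    ultimately have "eventually (\<lambda>n. D / D0 * h n < 1 + e) sequentially"
      using order_tendstoD(2) by fastforce
    with Kh[OF D(1)] show ?thesis by eventually_elim simp
  qed
  then obtain c where c: "\<And>n. c n > 0" "c \<longlonglongrightarrow> 1" "\<And>n. K n \<le> c n"
    using ex_majorant_tendsto_1 by metis
  show ?thesis
  proof (rule that[OF c(1,2)])
    fix n :: nat and u D assume n: "n \<ge> 1" and u: "u analytic_on (bernstein_ellipse \<rho> \<union> inside (bernstein_ellipse \<rho>))"
      and D: "gegenbauer_envelope lam D"
    define M where "M = (SUP z\<in>bernstein_ellipse \<rho>. cmod (u z))"
    define W where "W = sqrt (\<rho>^2 + 1 / \<rho>^2) / (\<rho> - 1)^2"
    have M: "M \<ge> 0" unfolding M_def using analytic_ellipse_sup_nonneg[OF \<rho> u] .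
    have W: "W \<ge> 0" by (simp add: W_def)
    have DD: "D0 \<le> D" unfolding D0_def using D bdd by (intro cInf_lower) auto
    have "(SUP x\<in>{-1..1::real}. cmod (u (complex_of_real x) - poly (gegenbauer_interp lam n u) (complex_of_real x)))
      \<le> S (n + 1) / L (n + 1) * M * sqrt (\<rho>\<^sup>2 + 1 / \<rho>\<^sup>2) * \<rho> / (\<rho> - 1)\<^sup>2"
      unfolding M_def
      by (rule gegenbauer_interpolation_error[OF lam' \<rho> u S L(1,3)])
    \<comment> \<open>\<open>D0\<close> is inserted to cancel its reciprocal in \<open>K\<close>; it
      is then enlarged to the given \<open>D\<close>.\<close>
    also have "\<dots> = K n * (D0 * (M * W * (G / m) * (1 / \<rho> ^ n)))"
      unfolding K_def W_def using G m \<rho> D0 by (simp add: field_simps)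
    also have "\<dots> \<le> c n * (D * (M * W * (G / m) * (1 / \<rho> ^ n)))"
      using c(3)[of n] c(1)[of n] M W G m \<rho> D0 DD by (intro mult_mono mult_nonneg_nonneg) auto
    also have "\<dots> = c n * D * G * M * sqrt (\<rho>^2 + 1 / \<rho>^2) / ((\<rho> - 1)^2 * m) * (1 / \<rho>^n)"
      by (simp add: W_def)
    finally show "(SUP x\<in>{-1..1::real}. cmod (u (complex_of_real x) - poly (gegenbauer_interp lam n u) (complex_of_real x)))
      \<le> c n * D * \<bar>Gamma lam\<bar> * (SUP z\<in>bernstein_ellipse \<rho>. cmod (u z)) * sqrt (\<rho>^2 + 1 / \<rho>^2)
                   / ((\<rho> - 1)^2 * (1 - 1 / \<rho>^2) powr (-lam))
                  * (1 / \<rho>^n)"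
      unfolding G_def m_eq M_def .
  qed
qed

theorem theorem4p1:
  fixes lam \<rho> :: real
  assumes "lam > -1/2" and "lam \<noteq> 0" and "\<rho> > 1"
  shows "\<exists>c :: nat \<Rightarrow> real. (\<forall>n. c n > 0) \<and> c \<longlonglongrightarrow> 1 \<and>
    (\<forall>n\<ge>1. \<forall>u :: complex \<Rightarrow> complex.
      u analytic_on (bernstein_ellipse \<rho> \<union> inside (bernstein_ellipse \<rho>)) \<longrightarrow>
      (let M = (SUP z\<in>bernstein_ellipse \<rho>. cmod (u z));
           err = (SUP x\<in>{-1..1::real}. cmod (u (complex_of_real x)
                    - poly (gegenbauer_interp lam n u) (complex_of_real x)))
       in
        (lam > 0 \<longrightarrow>
          err \<le> c n * Gamma lam * M * sqrt (\<rho>^2 + 1 / \<rho>^2)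
                 / (Gamma (2 * lam) * (\<rho> - 1)^2 * (1 + 1 / \<rho>^2) powr (-lam))
                * (real n powr lam / \<rho>^n)) \<and>
        (lam < 0 \<longrightarrow>
          (\<forall>D > 0.
            (\<forall>\<^sub>F k in sequentially. \<forall>x\<in>{-1..1::real}.
                \<bar>poly (gegenbauer lam k) x\<bar> \<le> D * real k powr (lam - 1)) \<longrightarrow>
            err \<le> c n * D * \<bar>Gamma lam\<bar> * M * sqrt (\<rho>^2 + 1 / \<rho>^2)
                   / ((\<rho> - 1)^2 * (1 - 1 / \<rho>^2) powr (-lam))
                  * (1 / \<rho>^n)))))"
proof (cases "lam > 0")
  case True
  obtain c where c: "\<And>n. c n > 0" "c \<longlonglongrightarrow> 1"
    "\<And>n u. \<lbrakk>n \<ge> 1; u analytic_on (bernstein_ellipse \<rho> \<union> inside (bernstein_ellipse \<rho>))\<rbrakk> \<Longrightarrow>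
      (SUP x\<in>{-1..1::real}. cmod (u (complex_of_real x) - poly (gegenbauer_interp lam n u) (complex_of_real x)))
      \<le> c n * Gamma lam * (SUP z\<in>bernstein_ellipse \<rho>. cmod (u z)) * sqrt (\<rho>^2 + 1 / \<rho>^2)
                 / (Gamma (2 * lam) * (\<rho> - 1)^2 * (1 + 1 / \<rho>^2) powr (-lam))
                * (real n powr lam / \<rho>^n)"
    using that by (rule gegenbauer_error_constant_pos[OF True assms(3)])
  show ?thesis unfolding Let_def
    by (intro exI[of _ c] conjI allI impI; (rule c; assumption | use True in simp))
next
  case False
  then have neg: "lam < 0" using assms(2) by simp
  obtain c where c: "\<And>n. c n > 0" "c \<longlonglongrightarrow> 1"
    "\<And>n u D. \<lbrakk>n \<ge> 1; u analytic_on (bernstein_ellipse \<rho> \<union> inside (bernstein_ellipse \<rho>)); gegenbauer_envelope lam D\<rbrakk> \<Longrightarrow>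
      (SUP x\<in>{-1..1::real}. cmod (u (complex_of_real x) - poly (gegenbauer_interp lam n u) (complex_of_real x)))
      \<le> c n * D * \<bar>Gamma lam\<bar> * (SUP z\<in>bernstein_ellipse \<rho>. cmod (u z)) * sqrt (\<rho>^2 + 1 / \<rho>^2)
                   / ((\<rho> - 1)^2 * (1 - 1 / \<rho>^2) powr (-lam))
                  * (1 / \<rho>^n)"
    using that by (rule gegenbauer_error_constant_neg[OF assms(1) neg assms(3)])
  show ?thesis unfolding Let_def
    by (intro exI[of _ c] conjI allI impI; (rule c; (assumption | simp add: gegenbauer_envelope_def) | use neg in simp))
qed

end
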